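(* Let $\kappa\in\mathbb{Z}_+\cup\{\infty\}$. There exist positive weights $\boldsymbol\lambda=\{\lambda_v\}_{v\in V^\circ}$ on the directed tree $\mathcal{T}_{\infty,\kappa}$ with vertex set $V$ such that the weighted shift $S_{\boldsymbol\lambda}$ in $\ell^2(V)$ has the following properties: (a) $S_{\boldsymbol\lambda}$ is closed and paranormal, and it is not hyponormal; (b) $S_{\boldsymbol\lambda}$ generates Stieltjes moment sequences; (c) $\mathcal{D}^\infty(S_{\boldsymbol\lambda})$ is a core of $S_{\boldsymbol\lambda}^n$ for every $n\in\mathbb{Z}_+$; (d) $S_{\boldsymbol\lambda}$ does not satisfy the consistency condition at $0$, i.e., for every $i\in\mathbb{N}$ the sequence $\{\|S_{\boldsymbol\lambda}^n e_{(i,1)}\|^2\}_{n=0}^\infty$ is a Stieltjes moment sequence with an S-representing measure $\mu_{i,1}$ such that $\sum_{i=1}^\infty \lambda_{(i,1)}^2\int_0^\infty\frac1x\,d\mu_{i,1}(x)>1$; (e) $S_{\boldsymbol\lambda}$ has no consistent system of measures; (f) $\{\|S_{\boldsymbol\lambda}^{n+1}e_0\|^2\}_{n=0}^\infty$ is an S-indeterminate Stieltjes moment sequence. Moreover, the weights can be chosen so that (a)–(f) hold and $\{\|S_{\boldsymbol\lambda}^{n}e_0\|^2\}_{n=0}^\infty$ is H-determinate, and they can also be chosen so that (a)–(f) hold and $\{\|S_{\boldsymbol\lambda}^{n}e_0\|^2\}_{n=0}^\infty$ is S-indeterminate.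
   Context: $\mathbb{N}=\{1,2,\ldots\}$, $\mathbb{Z}_+=\mathbb{N}\cup\{0\}$, $\mathbb{R}_+=[0,\infty)$, $\int_0^\infty=\int_{\mathbb{R}_+}$, and $\frac10:=\infty$. The tree: for $\kappa\in\mathbb{Z}_+\cup\{\infty\}$ let $J_\kappa=\{k\in\mathbb{N}\colon k\le\kappa\}$. $\mathcal{T}_{\infty,\kappa}=(V,E)$ has vertex set $V=\{-k\colon k\in J_\kappa\}\sqcup\{0\}\sqcup\{(i,j)\colon i,j\in\mathbb{N}\}$ and edge set $E=\{(-k,-k+1)\colon k\in J_\kappa\}\sqcup\{(0,(i,1))\colon i\in\mathbb{N}\}\sqcup\{((i,j),(i,j+1))\colon i,j\in\mathbb{N}\}$. If $\kappa<\infty$ its root is $-\kappa$ and $V^\circ=V\setminus\{-\kappa\}$; if $\kappa=\infty$ it has no root and $V^\circ=V$. For $v\in V^\circ$, $\mathrm{par}(v)$ is the unique $u$ with $(u,v)\in E$; $\mathrm{Chi}(u)=\{v\colon(u,v)\in E\}$. $\ell^2(V)$ is the complex Hilbert space of square summable functions on $V$ and $e_u$ is the characteristic function of $\{u\}$. The weighted shift $S_{\boldsymbol\lambda}$ with weights $\{\lambda_v\}_{v\in V^\circ}\subseteq\mathbb{C}$ is defined by $\mathcal{D}(S_{\boldsymbol\lambda})=\{f\in\ell^2(V)\colon\Lambda f\in\ell^2(V)\}$, $S_{\boldsymbol\lambda}f=\Lambda f$, where $(\Lambda f)(v)=\lambda_vf(\mathrm{par}(v))$ for $v\in V^\circ$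 and $(\Lambda f)(v)=0$ if $v$ is the root. For an operator $A$, $\mathcal{D}^\infty(A)=\bigcap_{n=0}^\infty\mathcal{D}(A^n)$. $A$ is paranormal if $\|Af\|^2\le\|f\|\|A^2f\|$ for all $f\in\mathcal{D}(A^2)$; hyponormal if it is densely defined, $\mathcal{D}(A)\subseteq\mathcal{D}(A^* )$ and $\|A^*f\|\le\|Af\|$ for $f\in\mathcal{D}(A)$. A linear subspace $\mathcal{E}\subseteq\mathcal{D}(A)$ is a core of $A$ if the graph of $A$ is contained in the closure of the graph of $A|_{\mathcal{E}}$. A sequence $\{\gamma_n\}_{n=0}^\infty\subseteq\mathbb{R}$ is a Stieltjes (respectively Hamburger) moment sequence if $\gamma_n=\int x^n\,d\mu(x)$, $n\in\mathbb{Z}_+$, for some positive Borel measure $\mu$ on $\mathbb{R}_+$ (respectively on $\mathbb{R}$), called an S-representing (respectively H-representing) measure. It is S-determinate (H-determinate) if it has exactly one S-representing (H-representing) measure, and otherwise S-indeterminate (H-indeterminate). An operator $S$ in a complex Hilbert space generates Stieltjes moment sequences if $\mathcal{D}^\infty(S)$ is dense and $\{\|S^nf\|^2\}_{n=0}^\infty$ is a Stieltjes moment sequence for every $f\in\mathcal{D}^\infty(S)$. A consistent system of measures for $S_{\boldsymbol\lambda}$ consists of Borel probability measures $\{\mu_v\}_{v\in V}$ on $\mathbb{R}_+$ and nonnegative reals $\{\varepsilon_v\}_{v\in V}$ with $\mu_u(\sigma)=\sum_{v\in\mathrm{Chi}(u)}|\lambda_v|^2\int_\sigma\frac1x\,d\mu_v(x)+\varepsilon_u\delta_0(\sigma)$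 for all Borel $\sigma\subseteq\mathbb{R}_+$ and all $u\in V$, where $\delta_0$ is the unit mass at $0$. *)

theory Defs
  imports "HOL-Probability.Probability"
begin

section \<open>The Hilbert space of square summable functions on a set\<close>

text \<open>
  Functions on \<open>V\<close> are represented by total functions on the ambient type that vanish outside \<open>V\<close>.
  Since \<^const>\<open>infsum\<close> is \<open>0\<close> on non-summable families, \<open>l2_norm f\<close> and \<open>l2_inner f g\<close> are meaningful
  only for square summable arguments.
\<close>

definition ell2 :: "'v set \<Rightarrow> ('v \<Rightarrow> complex) set" where
  "ell2 V = {f. (\<forall>v. v \<notin> V \<longrightarrow> f v = 0) \<and> (\<lambda>v. (cmod (f v))\<^sup>2) summable_on UNIV}"

definition l2_norm :: "('v \<Rightarrow> complex) \<Rightarrow> real" where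
  "l2_norm f = sqrt (\<Sum>\<^sub>\<infinity>v. (cmod (f v))\<^sup>2)"

definition l2_inner :: "('v \<Rightarrow> complex) \<Rightarrow> ('v \<Rightarrow> complex) \<Rightarrow> complex" where
  "l2_inner f g = (\<Sum>\<^sub>\<infinity>v. f v * cnj (g v))"

definition l2_dist :: "('v \<Rightarrow> complex) \<Rightarrow> ('v \<Rightarrow> complex) \<Rightarrow> real" where
  "l2_dist f g = l2_norm (\<lambda>v. f v - g v)"

definition l2_topology :: "'v set \<Rightarrow> ('v \<Rightarrow> complex) topology" where
  "l2_topology V = Metric_space.mtopology (ell2 V) l2_dist"

lemma l2_norm_nonneg: "0 \<le> l2_norm f"
  unfolding l2_norm_def by (intro real_sqrt_ge_zero infsum_nonneg) simp

lemma L2_set_le_l2_norm: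
  assumes "f \<in> ell2 V" "finite F"
  shows "L2_set (\<lambda>v. cmod (f v)) F \<le> l2_norm f"
  unfolding L2_set_def l2_norm_def
  using assms by (intro real_sqrt_le_mono finite_sum_le_infsum) (auto simp: ell2_def)

lemma ell2_add_norm:
  assumes f: "f \<in> ell2 V" and g: "g \<in> ell2 V"
  shows "(\<lambda>v. f v + g v) \<in> ell2 V"
    and "l2_norm (\<lambda>v. f v + g v) \<le> l2_norm f + l2_norm g"
proof -
  have le: "(\<Sum>v\<in>F. (cmod (f v + g v))\<^sup>2) \<le> (l2_norm f + l2_norm g)\<^sup>2" if "finite F" for F
  proof -
    have "L2_set (\<lambda>v. cmod (f v + g v)) F \<le> L2_set (\<lambda>v. cmod (f v) + cmod (g v)) F"
      by (intro L2_set_mono) (auto intro: norm_triangle_ineq)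
    also have "\<dots> \<le> L2_set (\<lambda>v. cmod (f v)) F + L2_set (\<lambda>v. cmod (g v)) F"
      by (rule L2_set_triangle_ineq)
    also have "\<dots> \<le> l2_norm f + l2_norm g"
      using L2_set_le_l2_norm[OF f that] L2_set_le_l2_norm[OF g that] by linarith
    finally have "(L2_set (\<lambda>v. cmod (f v + g v)) F)\<^sup>2 \<le> (l2_norm f + l2_norm g)\<^sup>2"
      by (intro power_mono) (auto simp: L2_set_nonneg)
    then show ?thesis
      by (simp add: L2_set_def sum_nonneg)
  qed
  have summable: "(\<lambda>v. (cmod (f v + g v))\<^sup>2) summable_on UNIV"
    by (rule nonneg_bdd_above_summable_on) (auto intro!: bdd_aboveI2 le)
  then show "(\<lambda>v. f v + g v) \<in> ell2 V"
    using f g by (auto simp: ell2_def)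
  have "(\<Sum>\<^sub>\<infinity>v. (cmod (f v + g v))\<^sup>2) \<le> (l2_norm f + l2_norm g)\<^sup>2"
    by (rule infsum_le_finite_sums[OF summable]) (use le in auto)
  then have "l2_norm (\<lambda>v. f v + g v) \<le> sqrt ((l2_norm f + l2_norm g)\<^sup>2)"
    unfolding l2_norm_def[of "\<lambda>v. f v + g v"] by (rule real_sqrt_le_mono)
  then show "l2_norm (\<lambda>v. f v + g v) \<le> l2_norm f + l2_norm g"
    using l2_norm_nonneg[of f] l2_norm_nonneg[of g] by simp
qed

lemma ell2_uminus: "g \<in> ell2 V \<Longrightarrow> (\<lambda>v. - g v) \<in> ell2 V"
  by (auto simp: ell2_def)

lemma ell2_diff:
  assumes "f \<in> ell2 V" "g \<in> ell2 V"
  shows "(\<lambda>v. f v - g v) \<in> ell2 V"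
  using ell2_add_norm(1)[OF assms(1) ell2_uminus[OF assms(2)]] by simp

lemma l2_norm_eq_0:
  assumes "f \<in> ell2 V"
  shows "l2_norm f = 0 \<longleftrightarrow> f = (\<lambda>_. 0)"
proof
  assume "l2_norm f = 0"
  show "f = (\<lambda>_. 0)"
  proof
    fix v
    have "L2_set (\<lambda>v. cmod (f v)) {v} \<le> 0"
      using L2_set_le_l2_norm[OF assms, of "{v}"] \<open>l2_norm f = 0\<close> by simp
    then show "f v = 0" by (simp add: L2_set_def)
  qed
qed (simp add: l2_norm_def)

lemma Metric_space_ell2: "Metric_space (ell2 V) l2_dist"
proof
  fix f g h :: "'a \<Rightarrow> complex"
  show "0 \<le> l2_dist f g"
    by (simp add: l2_dist_def l2_norm_nonneg)
  show "l2_dist f g = l2_dist g f"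
    by (simp add: l2_dist_def l2_norm_def norm_minus_commute)
  show "l2_dist f g = 0 \<longleftrightarrow> f = g" if "f \<in> ell2 V" "g \<in> ell2 V"
    using l2_norm_eq_0[OF ell2_diff[OF that]] by (auto simp: l2_dist_def fun_eq_iff)
  show "l2_dist f h \<le> l2_dist f g + l2_dist g h"
    if "f \<in> ell2 V" "g \<in> ell2 V" "h \<in> ell2 V"
    using ell2_add_norm(2)[OF ell2_diff[OF that(1,2)] ell2_diff[OF that(2,3)]]
    by (simp add: l2_dist_def)
qed


section \<open>Unbounded operators\<close>

text \<open>
  An operator in \<open>ell2 V\<close> is a partial function, with domain \<^term>\<open>dom A\<close> and graph
  \<^term>\<open>Map.graph A\<close>; the value \<open>A f\<close> for \<open>f \<in> dom A\<close> is \<^term>\<open>the (A f)\<close>.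
\<close>

type_synonym 'v l2_op = "('v \<Rightarrow> complex) \<rightharpoonup> ('v \<Rightarrow> complex)"

primrec op_power :: "'v set \<Rightarrow> 'v l2_op \<Rightarrow> nat \<Rightarrow> 'v l2_op" where
  "op_power V A 0 = Some |` ell2 V"
| "op_power V A (Suc n) = A \<circ>\<^sub>m op_power V A n"

definition dom_infty :: "'v set \<Rightarrow> 'v l2_op \<Rightarrow> ('v \<Rightarrow> complex) set" where
  "dom_infty V A = (\<Inter>n. dom (op_power V A n))"

definition dense_in_ell2 :: "'v set \<Rightarrow> ('v \<Rightarrow> complex) set \<Rightarrow> bool" where
  "dense_in_ell2 V D \<longleftrightarrow> D \<subseteq> ell2 V \<and> l2_topology V closure_of D = ell2 V"

definition closed_op :: "'v set \<Rightarrow> 'v l2_op \<Rightarrow> bool" where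
  "closed_op V A \<longleftrightarrow> closedin (prod_topology (l2_topology V) (l2_topology V)) (Map.graph A)"

definition complex_linear_subspace :: "('v \<Rightarrow> complex) set \<Rightarrow> bool" where
  "complex_linear_subspace E \<longleftrightarrow>
     (\<lambda>_. 0) \<in> E \<and> (\<forall>f\<in>E. \<forall>g\<in>E. (\<lambda>v. f v + g v) \<in> E) \<and> (\<forall>c. \<forall>f\<in>E. (\<lambda>v. c * f v) \<in> E)"

definition is_core :: "'v set \<Rightarrow> ('v \<Rightarrow> complex) set \<Rightarrow> 'v l2_op \<Rightarrow> bool" where
  "is_core V E A \<longleftrightarrow> complex_linear_subspace E \<and> E \<subseteq> dom A \<and>
     Map.graph A \<subseteq> prod_topology (l2_topology V) (l2_topology V) closure_of Map.graph (A |` E)"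

text \<open>For densely defined \<open>A\<close> the vector \<open>h\<close> below is unique.\<close>

definition adjoint_op :: "'v set \<Rightarrow> 'v l2_op \<Rightarrow> 'v l2_op" where
  "adjoint_op V A g =
     (if g \<in> ell2 V \<and> (\<exists>h\<in>ell2 V. \<forall>f\<in>dom A. l2_inner (the (A f)) g = l2_inner f h)
      then Some (THE h. h \<in> ell2 V \<and> (\<forall>f\<in>dom A. l2_inner (the (A f)) g = l2_inner f h))
      else None)"

definition paranormal :: "'v set \<Rightarrow> 'v l2_op \<Rightarrow> bool" where
  "paranormal V A \<longleftrightarrow>
     (\<forall>f\<in>dom (op_power V A 2). (l2_norm (the (A f)))\<^sup>2 \<le> l2_norm f * l2_norm (the (op_power V A 2 f)))"

definition hyponormal :: "'v set \<Rightarrow> 'v l2_op \<Rightarrow> bool" where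
  "hyponormal V A \<longleftrightarrow> dense_in_ell2 V (dom A) \<and> dom A \<subseteq> dom (adjoint_op V A) \<and>
     (\<forall>f\<in>dom A. l2_norm (the (adjoint_op V A f)) \<le> l2_norm (the (A f)))"


section \<open>Moment sequences\<close>

definition S_representing :: "(nat \<Rightarrow> real) \<Rightarrow> real measure \<Rightarrow> bool" where
  "S_representing \<gamma> \<mu> \<longleftrightarrow> sets \<mu> = sets (restrict_space borel {0..}) \<and>
     (\<forall>n. has_bochner_integral \<mu> (\<lambda>x. x ^ n) (\<gamma> n))"

definition H_representing :: "(nat \<Rightarrow> real) \<Rightarrow> real measure \<Rightarrow> bool" where
  "H_representing \<gamma> \<mu> \<longleftrightarrow> sets \<mu> = sets borel \<and>
     (\<forall>n. has_bochner_integral \<mu> (\<lambda>x. x ^ n) (\<gamma> n))"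

definition Stieltjes_moment_sequence :: "(nat \<Rightarrow> real) \<Rightarrow> bool" where
  "Stieltjes_moment_sequence \<gamma> \<longleftrightarrow> (\<exists>\<mu>. S_representing \<gamma> \<mu>)"

definition S_indeterminate :: "(nat \<Rightarrow> real) \<Rightarrow> bool" where
  "S_indeterminate \<gamma> \<longleftrightarrow> Stieltjes_moment_sequence \<gamma> \<and> \<not> (\<exists>!\<mu>. S_representing \<gamma> \<mu>)"

definition H_determinate :: "(nat \<Rightarrow> real) \<Rightarrow> bool" where
  "H_determinate \<gamma> \<longleftrightarrow> (\<exists>!\<mu>. H_representing \<gamma> \<mu>)"

text \<open>The sequence \<open>\<parallel>A\<^sup>n f\<parallel>\<^sup>2\<close>, meaningful for \<open>f \<in> dom_infty V A\<close>.\<close>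

definition norm_power_seq :: "'v set \<Rightarrow> 'v l2_op \<Rightarrow> ('v \<Rightarrow> complex) \<Rightarrow> nat \<Rightarrow> real" where
  "norm_power_seq V A f n = (l2_norm (the (op_power V A n f)))\<^sup>2"

definition generates_Stieltjes :: "'v set \<Rightarrow> 'v l2_op \<Rightarrow> bool" where
  "generates_Stieltjes V A \<longleftrightarrow> dense_in_ell2 V (dom_infty V A) \<and>
     (\<forall>f\<in>dom_infty V A. Stieltjes_moment_sequence (norm_power_seq V A f))"


section \<open>The directed tree and its weighted shifts\<close>

text \<open>
  \<open>Trunk k\<close> stands for the vertex \<open>-k\<close>, so \<open>Trunk 0\<close> is the branching vertex \<open>0\<close>, and \<open>Branch i j\<close>
  for \<open>(i, j)\<close>. The index set of the branches is \<open>{1, 2, \<dots>}\<close>, so \<open>Branch 0 j\<close> and \<open>Branch i 0\<close>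
  are not vertices of the tree.
\<close>

datatype vertex = Trunk nat | Branch nat nat

definition J_set :: "enat \<Rightarrow> nat set" where
  "J_set \<kappa> = {k. 1 \<le> k \<and> enat k \<le> \<kappa>}"

definition verts :: "enat \<Rightarrow> vertex set" where
  "verts \<kappa> = {Trunk k | k. k \<in> J_set \<kappa>} \<union> {Trunk 0} \<union> {Branch i j | i j. 1 \<le> i \<and> 1 \<le> j}"

definition edges :: "enat \<Rightarrow> (vertex \<times> vertex) set" where
  "edges \<kappa> = {(Trunk k, Trunk (k - 1)) | k. k \<in> J_set \<kappa>}
     \<union> {(Trunk 0, Branch i 1) | i. 1 \<le> i}
     \<union> {(Branch i j, Branch i (j + 1)) | i j. 1 \<le> i \<and> 1 \<le> j}"

definition verts_nonroot :: "enat \<Rightarrow> vertex set" where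
  "verts_nonroot \<kappa> = (case \<kappa> of enat k \<Rightarrow> verts \<kappa> - {Trunk k} | \<infinity> \<Rightarrow> verts \<kappa>)"

definition par :: "enat \<Rightarrow> vertex \<Rightarrow> vertex" where
  "par \<kappa> v = (THE u. (u, v) \<in> edges \<kappa>)"

definition Chi :: "enat \<Rightarrow> vertex \<Rightarrow> vertex set" where
  "Chi \<kappa> u = {v. (u, v) \<in> edges \<kappa>}"

definition basis_vec :: "vertex \<Rightarrow> vertex \<Rightarrow> complex" where
  "basis_vec u = indicator {u}"

definition shift_map :: "enat \<Rightarrow> (vertex \<Rightarrow> complex) \<Rightarrow> (vertex \<Rightarrow> complex) \<Rightarrow> vertex \<Rightarrow> complex" where
  "shift_map \<kappa> lam f v = (if v \<in> verts_nonroot \<kappa> then lam v * f (par \<kappa> v) else 0)"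

definition weighted_shift :: "enat \<Rightarrow> (vertex \<Rightarrow> complex) \<Rightarrow> vertex l2_op" where
  "weighted_shift \<kappa> lam f =
     (if f \<in> ell2 (verts \<kappa>) \<and> shift_map \<kappa> lam f \<in> ell2 (verts \<kappa>)
      then Some (shift_map \<kappa> lam f) else None)"

text \<open>
  Integrals of \<open>1/x\<close> are taken in \<^typ>\<open>ennreal\<close>, where \<^prop>\<open>inverse (0::ennreal) = top\<close>
  realises the convention \<open>1/0 = \<infinity>\<close>.
\<close>

definition consistent_system ::
    "enat \<Rightarrow> (vertex \<Rightarrow> complex) \<Rightarrow> (vertex \<Rightarrow> real measure) \<Rightarrow> (vertex \<Rightarrow> real) \<Rightarrow> bool" where
  "consistent_system \<kappa> lam \<mu> eps \<longleftrightarrow>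
     (\<forall>u\<in>verts \<kappa>. sets (\<mu> u) = sets (restrict_space borel {0..}) \<and> prob_space (\<mu> u) \<and> 0 \<le> eps u) \<and>
     (\<forall>u\<in>verts \<kappa>. \<forall>\<sigma>\<in>sets (restrict_space borel {0..}).
        emeasure (\<mu> u) \<sigma> =
          (\<Sum>\<^sub>\<infinity>v\<in>Chi \<kappa> u. ennreal ((cmod (lam v))\<^sup>2) * (\<integral>\<^sup>+x\<in>\<sigma>. inverse (ennreal x) \<partial>\<mu> v))
          + ennreal (eps u) * indicator \<sigma> 0)"

definition violates_consistency_at_0 :: "enat \<Rightarrow> (vertex \<Rightarrow> complex) \<Rightarrow> bool" where
  "violates_consistency_at_0 \<kappa> lam \<longleftrightarrow>
     (\<exists>\<mu> :: nat \<Rightarrow> real measure.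
        (\<forall>i\<ge>1. basis_vec (Branch i 1) \<in> dom_infty (verts \<kappa>) (weighted_shift \<kappa> lam) \<and>
           S_representing (norm_power_seq (verts \<kappa>) (weighted_shift \<kappa> lam) (basis_vec (Branch i 1))) (\<mu> i)) \<and>
        (\<Sum>i. ennreal ((cmod (lam (Branch (Suc i) 1)))\<^sup>2) * (\<integral>\<^sup>+x. inverse (ennreal x) \<partial>\<mu> (Suc i))) > 1)"

text \<open>
  Positive weights whose shift has all the properties common to both variants. The condition
  \<open>basis_vec (Trunk 0) \<in> dom_infty V S\<close>, without which \<open>\<parallel>S\<^sup>n e\<^sub>0\<parallel>\<close> is undefined, is implicit in
  the indeterminacy assertion.
\<close>

definition counterexample_weights :: "enat \<Rightarrow> (vertex \<Rightarrow> real) \<Rightarrow> bool" where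
  "counterexample_weights \<kappa> lam \<longleftrightarrow>
     (let V = verts \<kappa>; clam = (\<lambda>v. complex_of_real (lam v)); S = weighted_shift \<kappa> clam in
        (\<forall>v\<in>verts_nonroot \<kappa>. 0 < lam v) \<and>
        closed_op V S \<and> paranormal V S \<and> \<not> hyponormal V S \<and>
        generates_Stieltjes V S \<and>
        (\<forall>n. is_core V (dom_infty V S) (op_power V S n)) \<and>
        violates_consistency_at_0 \<kappa> clam \<and>
        \<not> (\<exists>\<mu> eps. consistent_system \<kappa> clam \<mu> eps) \<and>
        basis_vec (Trunk 0) \<in> dom_infty V S \<and>
        S_indeterminate (\<lambda>n. norm_power_seq V S (basis_vec (Trunk 0)) (n + 1)))"

end

theory Submission
  imports Defs
begin

text \<open>
  On the \<open>i\<close>th branch all weights beyond the first are \<open>\<surd>\<theta>\<^sub>i\<close>, so \<open>\<parallel>S\<^sup>n e\<^bsub>(i,1)\<^esub>\<parallel>\<^sup>2 = \<theta>\<^sub>i\<^sup>n\<close> and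
  \<open>\<parallel>S\<^bsup>n+1\<^esup> e\<^sub>0\<parallel>\<^sup>2\<close> is the \<open>n\<close>th moment of \<open>\<nu> = \<Sum>\<^sub>i \<lambda>\<^bsub>(i,1)\<^esub>\<^sup>2 \<delta>\<^bsub>\<theta> i\<^esub>\<close>. Since \<open>\<nu>\<close> is chosen with
  \<open>\<integral> 1/x d\<nu> > 1\<close>, the shift is neither hyponormal nor consistent at \<open>0\<close>. A second measure \<open>\<rho>\<close> with the
  moments of \<open>\<nu>\<close>, but with \<open>\<integral> 1/x d\<rho> = 1\<close>, nevertheless makes the trunk work: normalised multiples of
  \<open>x\<^bsup>-k-1\<^esup> d\<rho>\<close> represent \<open>\<parallel>S\<^sup>n e\<^bsub>-k\<^esub>\<parallel>\<^sup>2\<close>. As \<open>\<parallel>S\<^sup>n f\<parallel>\<^sup>2 = \<Sum>\<^sub>u \<bar>f(u)\<bar>\<^sup>2 \<parallel>S\<^sup>n e\<^sub>u\<parallel>\<^sup>2\<close> on a tree,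
  all of \<open>S\<close> generates Stieltjes moment sequences.
\<close>

text \<open>The two measures must agree in every moment yet differ in the integral of 1/x. Both come
  from one signed atomic measure on the powers of 4 whose moments all vanish while its integral of
  1/x is positive; splitting it by sign gives such a pair. The part with the larger inverse moment
  goes to the branches and exceeds what consistency allows; the trunk receives the other part,
  possibly mixed with some of the first, scaled to inverse moment 1. Common atoms in [1,\<infinity>)
  serve two ends: all negative moments are finite, so the trunk may be infinite, and the measures of
  different vertices add up atom by atom. Passing to \<open>e_0\<close> divides \<rho> by x, which
  is what separates the two variants. Division by x makes the pure odd part determinate, whereas a
  genuine mixture can be replaced by the odd part with some of the zeroth moment left over, and this
  surplus fits into an atom at 0.\<close>

instance vertex :: countable
  by countable_datatype

subsection \<open>Weighted energies\<close>

text \<open>With values in \<open>ennreal\<close> it is defined for every function, sums may be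
  interchanged freely, and membership in \<open>ell2\<close> or in the domain of a power becomes
  finiteness of an energy.\<close>

definition energy :: "('v \<Rightarrow> ennreal) \<Rightarrow> ('v \<Rightarrow> complex) \<Rightarrow> ennreal" where
  "energy g f = (\<integral>\<^sup>+v. ennreal ((cmod (f v))\<^sup>2) * g v \<partial>count_space UNIV)"

lemma ell2_energy_eq:
  assumes "f \<in> ell2 V"
  shows "energy (\<lambda>_. 1) f = ennreal ((l2_norm f)\<^sup>2)"
proof -
  have "Infinite_Set_Sum.abs_summable_on (\<lambda>v. (cmod (f v))\<^sup>2) UNIV"
    using assms by (simp add: ell2_def flip: abs_summable_equivalent)
  then have "energy (\<lambda>_. 1) f = ennreal (infsetsum (\<lambda>v. (cmod (f v))\<^sup>2) UNIV)"
    by (simp add: energy_def nn_integral_conv_infsetsum)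
  also have "infsetsum (\<lambda>v. (cmod (f v))\<^sup>2) UNIV = (\<Sum>\<^sub>\<infinity>v. (cmod (f v))\<^sup>2)"
    using assms by (subst infsetsum_infsum) (simp_all add: ell2_def flip: abs_summable_equivalent)
  finally show ?thesis
    by (simp add: l2_norm_def infsum_nonneg)
qed

lemma ell2_iff_energy:
  "f \<in> ell2 V \<longleftrightarrow> (\<forall>v. v \<notin> V \<longrightarrow> f v = 0) \<and> energy (\<lambda>_. 1) f < \<infinity>"
proof
  assume "f \<in> ell2 V"
  then show "(\<forall>v. v \<notin> V \<longrightarrow> f v = 0) \<and> energy (\<lambda>_. 1) f < \<infinity>"
    using ell2_energy_eq[of f V] by (auto simp: ell2_def)
next
  assume *: "(\<forall>v. v \<notin> V \<longrightarrow> f v = 0) \<and> energy (\<lambda>_. 1) f < \<infinity>"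
  then have "integrable (count_space UNIV) (\<lambda>v. (cmod (f v))\<^sup>2)"
    by (intro integrableI_bounded) (auto simp: energy_def)
  then have "(\<lambda>v. (cmod (f v))\<^sup>2) summable_on UNIV"
    using abs_summable_equivalent[of "\<lambda>v. (cmod (f v))\<^sup>2" UNIV] by (simp add: abs_summable_on_def)
  then show "f \<in> ell2 V"
    using * by (simp add: ell2_def)
qed

lemma energy_finite_supp:
  assumes "finite F"
  shows "energy g (\<lambda>v. if v \<in> F then f v else 0) = (\<Sum>v\<in>F. ennreal ((cmod (f v))\<^sup>2) * g v)"
  unfolding energy_def
  by (subst nn_integral_count_space'[OF assms]) (auto split: if_splits)

text \<open>Dominated convergence along the finite sets cut out by an enumeration, hence the need
  for a countable type.\<close>

lemma energy_tail:
  fixes f :: "'v :: countable \<Rightarrow> complex"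
  assumes "energy g f < \<infinity>" "0 < e"
  shows "\<exists>F. finite F \<and> energy g (\<lambda>v. if v \<in> F then 0 else f v) < e"
proof -
  define h where "h v = ennreal ((cmod (f v))\<^sup>2) * g v" for v
  define F where "F n = {v :: 'v. to_nat v < n}" for n
  have fin: "finite (F n)" for n
    using finite_vimageI[of "{..<n}" to_nat] by (simp add: F_def vimage_def lessThan_def)
  have "(\<lambda>n. \<integral>\<^sup>+v. h v * indicator (- F n) v \<partial>count_space UNIV) \<longlonglongrightarrow> (\<integral>\<^sup>+v. 0 \<partial>count_space (UNIV :: 'v set))"
  proof (rule nn_integral_dominated_convergence[where w = h])
    show "(\<integral>\<^sup>+v. h v \<partial>count_space UNIV) < \<infinity>"
      using assms(1) by (simp add: energy_def h_def)
    have "(\<lambda>n. h v * indicator (- F n) v) \<longlonglongrightarrow> 0" for v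
      by (rule tendsto_eventually, rule eventually_mono[OF eventually_gt_at_top[of "to_nat v"]])
         (simp add: F_def)
    then show "AE v in count_space UNIV. (\<lambda>n. h v * indicator (- F n) v) \<longlonglongrightarrow> 0"
      by simp
  qed (auto simp: indicator_def)
  then have "\<forall>\<^sub>F n in sequentially. (\<integral>\<^sup>+v. h v * indicator (- F n) v \<partial>count_space UNIV) < e"
    using assms(2) by (simp add: order_tendstoD)
  then obtain n where n: "(\<integral>\<^sup>+v. h v * indicator (- F n) v \<partial>count_space UNIV) < e"
    by (auto simp: eventually_sequentially)
  have "energy g (\<lambda>v. if v \<in> F n then 0 else f v) = (\<integral>\<^sup>+v. h v * indicator (- F n) v \<partial>count_space UNIV)"
    unfolding energy_def h_def by (intro nn_integral_cong) (auto simp: indicator_def)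
  with n have "finite (F n) \<and> energy g (\<lambda>v. if v \<in> F n then 0 else f v) < e"
    using fin by simp
  then show ?thesis ..
qed

text \<open>Serves twice: over the atoms of the measure at one vertex, and over the vertices of the
  tree. In the second use nothing is known outside the tree, so the hypothesis is confined to the
  support of \<open>f\<close>.\<close>

lemma energy_Cauchy_Schwarz:
  assumes "\<And>v. f v \<noteq> 0 \<Longrightarrow> (g v)\<^sup>2 \<le> h v"
  shows "(energy g f)\<^sup>2 \<le> energy (\<lambda>_. 1) f * energy h f"
proof -
  have "(energy g f)\<^sup>2 = (\<integral>\<^sup>+v. ennreal (cmod (f v)) * (ennreal (cmod (f v)) * g v) \<partial>count_space UNIV)\<^sup>2"
    by (simp add: energy_def power2_eq_square ennreal_mult mult.assoc)
  also have "\<dots> \<le> (\<integral>\<^sup>+v. (ennreal (cmod (f v)))\<^sup>2 \<partial>count_space UNIV) *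
      (\<integral>\<^sup>+v. (ennreal (cmod (f v)) * g v)\<^sup>2 \<partial>count_space UNIV)"
    by (rule Cauchy_Schwarz_nn_integral) auto
  also have "(\<integral>\<^sup>+v. (ennreal (cmod (f v)))\<^sup>2 \<partial>count_space UNIV) = energy (\<lambda>_. 1) f"
    by (simp add: energy_def ennreal_power)
  also have "(\<integral>\<^sup>+v. (ennreal (cmod (f v)) * g v)\<^sup>2 \<partial>count_space UNIV) \<le> energy h f"
    unfolding energy_def
  proof (rule nn_integral_mono)
    fix v
    show "(ennreal (cmod (f v)) * g v)\<^sup>2 \<le> ennreal ((cmod (f v))\<^sup>2) * h v"
      using assms[of v] by (cases "f v = 0") (auto simp: power_mult_distrib ennreal_power intro: mult_left_mono)
  qed
  finally show ?thesis by (simp add: mult_left_mono)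
qed

subsection \<open>Closures in the graph topology\<close>

lemma in_l2_closure_of:
  assumes "G \<subseteq> ell2 V" "f \<in> ell2 V" "\<And>e. 0 < e \<Longrightarrow> \<exists>g\<in>G. l2_dist f g < e"
  shows "f \<in> l2_topology V closure_of G"
proof -
  interpret Metric_space "ell2 V" l2_dist by (rule Metric_space_ell2)
  show ?thesis
    unfolding l2_topology_def metric_closure_of using assms by auto (meson subsetD)
qed

lemma in_l2_prod_closure_of:
  assumes "G \<subseteq> ell2 V \<times> ell2 V" "f \<in> ell2 V" "g \<in> ell2 V"
    "\<And>e. 0 < e \<Longrightarrow> \<exists>(f', g')\<in>G. l2_dist f f' < e \<and> l2_dist g g' < e"
  shows "(f, g) \<in> prod_topology (l2_topology V) (l2_topology V) closure_of G"
proof -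
  interpret Metric_space "ell2 V" l2_dist by (rule Metric_space_ell2)
  show ?thesis
    unfolding in_closure_of
  proof (intro conjI allI impI)
    show "(f, g) \<in> topspace (prod_topology (l2_topology V) (l2_topology V))"
      using assms by (simp add: l2_topology_def)
    fix T assume "(f, g) \<in> T \<and> openin (prod_topology (l2_topology V) (l2_topology V)) T"
    then obtain A B where AB: "openin mtopology A" "openin mtopology B" "f \<in> A" "g \<in> B" "A \<times> B \<subseteq> T"
      unfolding openin_prod_topology_alt l2_topology_def by blast
    obtain r s where "0 < r" "mball f r \<subseteq> A" "0 < s" "mball g s \<subseteq> B"
      using AB unfolding openin_mtopology by meson
    moreover obtain f' g' where "(f', g') \<in> G" "l2_dist f f' < min r s" "l2_dist g g' < min r s"
      using assms(4)[of "min r s"] \<open>0 < r\<close> \<open>0 < s\<close> by auto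
    moreover have "f' \<in> ell2 V" "g' \<in> ell2 V"
      using \<open>(f', g') \<in> G\<close> assms(1) by auto
    ultimately have "f' \<in> mball f r" "g' \<in> mball g s"
      using assms(2,3) by simp_all
    then have "f' \<in> A" "g' \<in> B"
      using \<open>mball f r \<subseteq> A\<close> \<open>mball g s \<subseteq> B\<close> by blast+
    then show "\<exists>y. y \<in> G \<and> y \<in> T"
      using AB(5) \<open>(f', g') \<in> G\<close> by blast
  qed
qed

text \<open>A single coordinate is bounded by the norm. Continuous coordinates reduce the closedness
  of the graph to pointwise equations.\<close>

lemma continuous_map_l2_eval: "continuous_map (l2_topology V) euclidean (\<lambda>f. f v)"
proof -
  interpret Metric_space "ell2 V" l2_dist by (rule Metric_space_ell2)
  have le: "cmod (f v - g v) \<le> l2_dist f g" if "f \<in> ell2 V" "g \<in> ell2 V" for f g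
    using L2_set_le_l2_norm[OF ell2_diff[OF that], of "{v}"] by (simp add: l2_dist_def)
  show ?thesis
    unfolding l2_topology_def continuous_map_from_metric
  proof (intro conjI ballI allI impI)
    fix f and U :: "complex set" assume "f \<in> ell2 V" and U: "openin euclidean U \<and> f v \<in> U"
    then obtain r where r: "0 < r" "ball (f v) r \<subseteq> U"
      by (meson open_contains_ball open_openin)
    then show "\<exists>r>0. \<forall>g. g \<in> ell2 V \<and> l2_dist f g < r \<longrightarrow> g v \<in> U"
      using le[OF \<open>f \<in> ell2 V\<close>] by (intro exI[of _ r]) (force simp: dist_norm)
  qed simp
qed

subsection \<open>Powers of a weighted shift\<close>

lemma verts_simps [simp]:
  "Trunk k \<in> verts \<kappa> \<longleftrightarrow> enat k \<le> \<kappa>"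
  "Branch i j \<in> verts \<kappa> \<longleftrightarrow> 1 \<le> i \<and> 1 \<le> j"
  by (cases k) (auto simp: verts_def J_set_def zero_enat_def[symmetric])

lemma verts_nonroot_simps [simp]:
  "Trunk k \<in> verts_nonroot \<kappa> \<longleftrightarrow> enat (Suc k) \<le> \<kappa>"
  "Branch i j \<in> verts_nonroot \<kappa> \<longleftrightarrow> 1 \<le> i \<and> 1 \<le> j"
  by (cases \<kappa>; auto simp: verts_nonroot_def)+

lemma verts_nonroot_subset: "verts_nonroot \<kappa> \<subseteq> verts \<kappa>"
  by (cases \<kappa>) (auto simp: verts_nonroot_def)

lemma edges_iff:
  "(u, v) \<in> edges \<kappa> \<longleftrightarrow>
    (\<exists>k. u = Trunk (Suc k) \<and> v = Trunk k \<and> enat (Suc k) \<le> \<kappa>) \<or>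
    (\<exists>i\<ge>1. u = Trunk 0 \<and> v = Branch i 1) \<or>
    (\<exists>i j. u = Branch i j \<and> v = Branch i (Suc j) \<and> 1 \<le> i \<and> 1 \<le> j)"
proof -
  have "J_set \<kappa> = {Suc k |k. enat (Suc k) \<le> \<kappa>}"
    by (auto simp: J_set_def) (metis Suc_le_D)
  then show ?thesis
    by (auto simp: edges_def)
qed

lemma par_simps [simp]:
  "enat (Suc k) \<le> \<kappa> \<Longrightarrow> par \<kappa> (Trunk k) = Trunk (Suc k)"
  "1 \<le> i \<Longrightarrow> par \<kappa> (Branch i (Suc 0)) = Trunk 0"
  "1 \<le> i \<Longrightarrow> 1 \<le> j \<Longrightarrow> par \<kappa> (Branch i (Suc j)) = Branch i j"
  by (auto simp: par_def edges_iff intro!: the_equality)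

lemma nonroot_cases:
  assumes "v \<in> verts_nonroot \<kappa>"
  obtains k where "v = Trunk k" "enat (Suc k) \<le> \<kappa>"
  | i where "v = Branch i (Suc 0)" "1 \<le> i"
  | i j where "v = Branch i (Suc j)" "1 \<le> i" "1 \<le> j"
proof (cases v)
  case (Branch i j)
  with assms obtain j' where "j = Suc j'" "1 \<le> i"
    by (cases j) auto
  with that(2,3) Branch show ?thesis
    by (cases j') auto
qed (use assms that in auto)

lemma Chi_simps:
  "enat (Suc k) \<le> \<kappa> \<Longrightarrow> Chi \<kappa> (Trunk (Suc k)) = {Trunk k}"
  "Chi \<kappa> (Trunk 0) = range (\<lambda>i. Branch (Suc i) (Suc 0))"
  "1 \<le> i \<Longrightarrow> 1 \<le> j \<Longrightarrow> Chi \<kappa> (Branch i j) = {Branch i (Suc j)}"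
  by (auto simp: Chi_def edges_iff image_iff) (metis Suc_le_D)

lemma Chi_par: "Chi \<kappa> u = {v \<in> verts_nonroot \<kappa>. par \<kappa> v = u}"
  by (auto simp: Chi_def edges_iff elim!: nonroot_cases)

text \<open>This is ||S^n e_u||^2, computed along the children so that it makes sense even when
  infinite.\<close>

primrec growth :: "enat \<Rightarrow> (vertex \<Rightarrow> complex) \<Rightarrow> nat \<Rightarrow> vertex \<Rightarrow> ennreal" where
  "growth \<kappa> lam 0 = (\<lambda>_. 1)"
| "growth \<kappa> lam (Suc n) = (\<lambda>u. \<integral>\<^sup>+v. ennreal ((cmod (lam v))\<^sup>2) * growth \<kappa> lam n v \<partial>count_space (Chi \<kappa> u))"

text \<open>A vertex has at most one parent, so the image of \<open>f\<close> has no cross terms;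
  Tonelli over the pairs (parent, child) moves the shift from the function to the weight.\<close>

lemma energy_shift_map: "energy g (shift_map \<kappa> lam f) =
    energy (\<lambda>u. \<integral>\<^sup>+v. ennreal ((cmod (lam v))\<^sup>2) * g v \<partial>count_space (Chi \<kappa> u)) f"
proof -
  define G where "G u v = ennreal ((cmod (f u))\<^sup>2) * (ennreal ((cmod (lam v))\<^sup>2) * g v) * indicator (Chi \<kappa> u) v" for u v
  have *: "ennreal ((cmod (shift_map \<kappa> lam f v))\<^sup>2) * g v = (\<integral>\<^sup>+u. G u v \<partial>count_space UNIV)" for v
  proof (cases "v \<in> verts_nonroot \<kappa>")
    case True
    then have "(\<integral>\<^sup>+u. G u v \<partial>count_space UNIV) = (\<Sum>u\<in>{par \<kappa> v}. G u v)"
      by (intro nn_integral_count_space') (auto simp: G_def Chi_par indicator_def)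
    also have "\<dots> = ennreal ((cmod (shift_map \<kappa> lam f v))\<^sup>2) * g v"
      using True by (simp add: G_def Chi_par shift_map_def norm_mult power_mult_distrib ennreal_mult mult_ac)
    finally show ?thesis ..
  qed (simp add: G_def Chi_par shift_map_def)
  have "energy g (shift_map \<kappa> lam f) = (\<integral>\<^sup>+v. \<integral>\<^sup>+u. G u v \<partial>count_space UNIV \<partial>count_space UNIV)"
    by (simp add: energy_def *)
  also have "\<dots> = (\<integral>\<^sup>+u. \<integral>\<^sup>+v. G u v \<partial>count_space UNIV \<partial>count_space UNIV)"
    by (rule nn_integral_count_space_nn_integral) auto
  also have "\<dots> = energy (\<lambda>u. \<integral>\<^sup>+v. ennreal ((cmod (lam v))\<^sup>2) * g v \<partial>count_space (Chi \<kappa> u)) f"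
    unfolding energy_def
    by (intro nn_integral_cong)
       (simp add: G_def nn_integral_count_space_indicator mult.assoc nn_integral_cmult)
  finally show ?thesis .
qed

text \<open>Each shift moved into the weight raises the index of \<open>growth\<close> by one, so
  the induction has to start from an arbitrary index \<open>m\<close>.\<close>

lemma energy_shift_power: "energy (\<lambda>_. 1) ((shift_map \<kappa> lam ^^ n) f) = energy (growth \<kappa> lam n) f"
proof -
  have "energy (growth \<kappa> lam m) ((shift_map \<kappa> lam ^^ n) f) = energy (growth \<kappa> lam (m + n)) f" for m
  proof (induction n arbitrary: m)
    case (Suc n)
    have "energy (growth \<kappa> lam m) ((shift_map \<kappa> lam ^^ Suc n) f) =
        energy (growth \<kappa> lam (Suc m)) ((shift_map \<kappa> lam ^^ n) f)"
      by (simp add: energy_shift_map)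
    also have "\<dots> = energy (growth \<kappa> lam (m + Suc n)) f"
      by (simp only: Suc.IH add_Suc add_Suc_right)
    finally show ?case .
  qed simp
  from this[of 0] show ?thesis by simp
qed

section \<open>Linearity and domains of the powers\<close>

lemma shift_power_diff:
  "(shift_map \<kappa> lam ^^ n) (\<lambda>v. f v - g v) = (\<lambda>v. (shift_map \<kappa> lam ^^ n) f v - (shift_map \<kappa> lam ^^ n) g v)"
proof (induction n)
  case (Suc n)
  show ?case
    unfolding funpow.simps o_apply Suc.IH by (auto simp: shift_map_def algebra_simps)
qed simp

lemma shift_power_add:
  "(shift_map \<kappa> lam ^^ n) (\<lambda>v. f v + g v) = (\<lambda>v. (shift_map \<kappa> lam ^^ n) f v + (shift_map \<kappa> lam ^^ n) g v)"
proof (induction n)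
  case (Suc n)
  show ?case
    unfolding funpow.simps o_apply Suc.IH by (auto simp: shift_map_def algebra_simps)
qed simp

lemma shift_power_cmult:
  "(shift_map \<kappa> lam ^^ n) (\<lambda>v. c * f v) = (\<lambda>v. c * (shift_map \<kappa> lam ^^ n) f v)"
proof (induction n)
  case (Suc n)
  show ?case
    unfolding funpow.simps o_apply Suc.IH by (auto simp: shift_map_def algebra_simps)
qed simp

lemma shift_power_in_ell2_iff:
  assumes "\<And>v. v \<notin> verts \<kappa> \<Longrightarrow> f v = 0"
  shows "(shift_map \<kappa> lam ^^ n) f \<in> ell2 (verts \<kappa>) \<longleftrightarrow> energy (growth \<kappa> lam n) f < \<infinity>"
proof -
  have "(shift_map \<kappa> lam ^^ n) f v = 0" if "v \<notin> verts \<kappa>" for v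
    using that assms verts_nonroot_subset[of \<kappa>] by (cases n) (auto simp: shift_map_def)
  then show ?thesis
    by (simp add: ell2_iff_energy energy_shift_power)
qed

lemma op_power_weighted_shift:
  "op_power (verts \<kappa>) (weighted_shift \<kappa> lam) n f =
     (if \<forall>k\<le>n. (shift_map \<kappa> lam ^^ k) f \<in> ell2 (verts \<kappa>) then Some ((shift_map \<kappa> lam ^^ n) f) else None)"
proof (induction n)
  case (Suc n)
  then show ?case
    by (auto simp: map_comp_def weighted_shift_def le_Suc_eq)
qed (simp add: restrict_map_def)

lemma dom_infty_weighted_shift:
  "dom_infty (verts \<kappa>) (weighted_shift \<kappa> lam) = {f. \<forall>n. (shift_map \<kappa> lam ^^ n) f \<in> ell2 (verts \<kappa>)}"
  by (auto simp: dom_infty_def dom_def op_power_weighted_shift split: if_splits)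

lemma norm_power_seq_weighted_shift:
  assumes "f \<in> dom_infty (verts \<kappa>) (weighted_shift \<kappa> lam)"
  shows "ennreal (norm_power_seq (verts \<kappa>) (weighted_shift \<kappa> lam) f n) = energy (growth \<kappa> lam n) f"
  using assms ell2_energy_eq[of "(shift_map \<kappa> lam ^^ n) f" "verts \<kappa>"]
  by (simp add: norm_power_seq_def op_power_weighted_shift dom_infty_weighted_shift energy_shift_power)

lemma ell2_cmult: "f \<in> ell2 V \<Longrightarrow> (\<lambda>v. c * f v) \<in> ell2 V"
  by (auto simp: ell2_def norm_mult power_mult_distrib intro: summable_on_cmult_right)

lemma dom_infty_subset: "dom_infty (verts \<kappa>) (weighted_shift \<kappa> lam) \<subseteq> ell2 (verts \<kappa>)"
proof
  fix f assume "f \<in> dom_infty (verts \<kappa>) (weighted_shift \<kappa> lam)"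
  then have "(shift_map \<kappa> lam ^^ 0) f \<in> ell2 (verts \<kappa>)"
    unfolding dom_infty_weighted_shift by blast
  then show "f \<in> ell2 (verts \<kappa>)" by simp
qed

lemma subspace_dom_infty: "complex_linear_subspace (dom_infty (verts \<kappa>) (weighted_shift \<kappa> lam))"
proof -
  have "(shift_map \<kappa> lam ^^ n) (\<lambda>_. 0) = (\<lambda>_. 0)" for n
    using shift_power_cmult[of n \<kappa> lam 0 "\<lambda>_. 0"] by simp
  moreover have "(\<lambda>_. 0) \<in> ell2 (verts \<kappa>)"
    by (simp add: ell2_def)
  ultimately show ?thesis
    by (simp add: complex_linear_subspace_def dom_infty_weighted_shift shift_power_add shift_power_cmult
        ell2_add_norm(1) ell2_cmult)
qed

text \<open>Every coordinate of the image depends on one coordinate of \<open>f\<close>, so the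
  graph is an intersection of equalizers of continuous maps. The domain condition is automatic: both
  components of a point of the product already lie in \<open>ell2\<close>.\<close>

lemma closed_weighted_shift: "closed_op (verts \<kappa>) (weighted_shift \<kappa> lam)"
proof -
  let ?X = "l2_topology (verts \<kappa>)" and ?P = "prod_topology (l2_topology (verts \<kappa>)) (l2_topology (verts \<kappa>))"
  have top: "topspace ?X = ell2 (verts \<kappa>)"
    by (simp add: l2_topology_def Metric_space.topspace_mtopology[OF Metric_space_ell2])
  have "Map.graph (weighted_shift \<kappa> lam) =
      (\<Inter>v. {p \<in> topspace ?P. snd p v = shift_map \<kappa> lam (fst p) v})"
    by (auto simp: Map.graph_def weighted_shift_def top fun_eq_iff split: if_splits)
       (metis ext)+
  moreover have "closedin ?P {p \<in> topspace ?P. snd p v = shift_map \<kappa> lam (fst p) v}" for v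
  proof (rule closedin_continuous_maps_eq)
    show "continuous_map ?P euclidean (\<lambda>p. snd p v)"
      using continuous_map_compose[OF continuous_map_snd continuous_map_l2_eval] by (simp add: o_def)
    have "continuous_map ?P euclidean (\<lambda>p. fst p (par \<kappa> v))"
      using continuous_map_compose[OF continuous_map_fst continuous_map_l2_eval] by (simp add: o_def)
    from continuous_map_compose[OF this, of euclidean "\<lambda>z. lam v * z"]
    show "continuous_map ?P euclidean (\<lambda>p. shift_map \<kappa> lam (fst p) v)"
      by (auto simp: shift_map_def o_def intro: continuous_intros)
  qed simp
  ultimately show ?thesis
    unfolding closed_op_def by (simp only:) (rule closedin_Inter; blast)
qed

text \<open>The assumption says that every basis vector lies in the domain of every power. Density
  and the core property follow from this alone.\<close>

locale finite_growth =
  fixes \<kappa> :: enat and lam :: "vertex \<Rightarrow> complex"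
  assumes growth_finite: "u \<in> verts \<kappa> \<Longrightarrow> growth \<kappa> lam n u < \<infinity>"
begin

abbreviation "V \<equiv> verts \<kappa>"
abbreviation "S \<equiv> weighted_shift \<kappa> lam"
abbreviation "L \<equiv> shift_map \<kappa> lam"

lemma finite_support_dom_infty:
  assumes "finite F" "\<And>v. v \<notin> V \<Longrightarrow> f v = 0"
  shows "(\<lambda>v. if v \<in> F then f v else 0) \<in> dom_infty V S"
  unfolding dom_infty_weighted_shift
proof (intro CollectI allI)
  fix n
  have "ennreal ((cmod (f v))\<^sup>2) * growth \<kappa> lam n v < \<infinity>" for v
    using assms(2)[of v] growth_finite[of v n] by (cases "v \<in> V") (auto simp: ennreal_mult_less_top)
  then have "energy (growth \<kappa> lam n) (\<lambda>v. if v \<in> F then f v else 0) < \<infinity>"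
    by (simp add: energy_finite_supp[OF assms(1)] assms(1))
  then show "(L ^^ n) (\<lambda>v. if v \<in> F then f v else 0) \<in> ell2 V"
    by (subst shift_power_in_ell2_iff) (auto simp: assms(2))
qed

lemma basis_vec_dom_infty:
  assumes "u \<in> V"
  shows "basis_vec u \<in> dom_infty V S"
proof -
  have "(\<lambda>v. if v \<in> {u} then basis_vec u v else 0) = basis_vec u"
    by (auto simp: basis_vec_def)
  then show ?thesis
    using finite_support_dom_infty[of "{u}" "basis_vec u"] assms
    by (metis (full_types) basis_vec_def finite.emptyI finite_insert indicator_simps(2) singletonD)
qed

lemma energy_basis_vec: "energy g (basis_vec u) = g u"
proof -
  have "(\<lambda>v. if v \<in> {u} then 1 else 0) = basis_vec u"
    by (auto simp: basis_vec_def)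
  then show ?thesis
    using energy_finite_supp[of "{u}" g "\<lambda>_. 1"] by simp
qed

text \<open>Cutting \<open>f\<close> down to finitely many vertices changes \<open>f\<close> and its
  nth image by tails of two energies. Both are dominated by the tail for the weight 1 +
  \<open>growth\<close> of index n, so one finite set serves both.\<close>

lemma truncation:
  assumes f: "\<And>k. k \<le> n \<Longrightarrow> (L ^^ k) f \<in> ell2 V" and "0 < e"
  shows "\<exists>g\<in>dom_infty V S. l2_dist f g < e \<and> l2_dist ((L ^^ n) f) ((L ^^ n) g) < e"
proof -
  have f0: "f v = 0" if "v \<notin> V" for v
    using f[of 0] that by (simp add: ell2_def)
  define h where "h v = 1 + growth \<kappa> lam n v" for v
  have "energy h f = energy (growth \<kappa> lam 0) f + energy (growth \<kappa> lam n) f"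
    unfolding energy_def h_def by (simp add: distrib_left nn_integral_add)
  also have "\<dots> < \<infinity>"
    using f[of 0] f[of n] f0 shift_power_in_ell2_iff[of \<kappa> f 0 lam] shift_power_in_ell2_iff[of \<kappa> f n lam] by simp
  finally have "energy h f < \<infinity>" .
  then obtain F where F: "finite F" "energy h (\<lambda>v. if v \<in> F then 0 else f v) < ennreal (e\<^sup>2)"
    using energy_tail[of h f "ennreal (e\<^sup>2)"] \<open>0 < e\<close> by auto
  define g where "g v = (if v \<in> F then f v else 0)" for v
  have g: "g \<in> dom_infty V S"
    using finite_support_dom_infty[OF F(1), of f] f0 unfolding g_def by blast
  have diff: "(\<lambda>v. f v - g v) = (\<lambda>v. if v \<in> F then 0 else f v)"
    by (auto simp: g_def)
  have small: "l2_dist ((L ^^ k) f) ((L ^^ k) g) < e" if "k \<le> n" "\<And>v. growth \<kappa> lam k v \<le> h v" for k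
  proof -
    have "ennreal ((l2_dist ((L ^^ k) f) ((L ^^ k) g))\<^sup>2) = energy (\<lambda>_. 1) (\<lambda>v. (L ^^ k) f v - (L ^^ k) g v)"
      unfolding l2_dist_def
      using f[OF that(1)] g by (subst ell2_energy_eq) (auto simp: dom_infty_weighted_shift intro: ell2_diff)
    also have "\<dots> = energy (growth \<kappa> lam k) (\<lambda>v. if v \<in> F then 0 else f v)"
      by (simp add: energy_shift_power diff flip: shift_power_diff)
    also have "\<dots> \<le> energy h (\<lambda>v. if v \<in> F then 0 else f v)"
      unfolding energy_def by (intro nn_integral_mono mult_left_mono that) simp
    also note F(2)
    finally have "(l2_dist ((L ^^ k) f) ((L ^^ k) g))\<^sup>2 < e\<^sup>2"
      by (simp add: ennreal_less_iff)
    then show ?thesis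
      using \<open>0 < e\<close> by (simp add: power_less_imp_less_base)
  qed
  show ?thesis
    using g small[of 0] small[of n] by (auto simp: h_def)
qed

lemma dense_dom_infty: "dense_in_ell2 V (dom_infty V S)"
proof -
  have "f \<in> l2_topology V closure_of dom_infty V S" if "f \<in> ell2 V" for f
    using that truncation[of 0 f] by (intro in_l2_closure_of[OF dom_infty_subset that]) auto
  moreover have "l2_topology V closure_of dom_infty V S \<subseteq> ell2 V"
    using closure_of_subset_topspace[of "l2_topology V"]
    by (simp add: l2_topology_def Metric_space.topspace_mtopology[OF Metric_space_ell2])
  ultimately show ?thesis
    using dom_infty_subset by (auto simp: dense_in_ell2_def)
qed

lemma core_dom_infty: "is_core V (dom_infty V S) (op_power V S n)"
  unfolding is_core_def
proof (intro conjI)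
  show sub: "dom_infty V S \<subseteq> dom (op_power V S n)"
    by (auto simp: dom_infty_def)
  show "Map.graph (op_power V S n) \<subseteq>
      prod_topology (l2_topology V) (l2_topology V) closure_of Map.graph (op_power V S n |` dom_infty V S)"
  proof safe
    fix f g assume "(f, g) \<in> Map.graph (op_power V S n)"
    then have f: "\<And>k. k \<le> n \<Longrightarrow> (L ^^ k) f \<in> ell2 V" and g: "g = (L ^^ n) f"
      by (auto simp: Map.graph_def op_power_weighted_shift split: if_splits)
    have graph: "Map.graph (op_power V S n |` dom_infty V S) = {(h, (L ^^ n) h) |h. h \<in> dom_infty V S}"
      by (auto simp: Map.graph_def restrict_map_def op_power_weighted_shift dom_infty_weighted_shift split: if_splits)
    show "(f, g) \<in> prod_topology (l2_topology V) (l2_topology V) closure_of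
        Map.graph (op_power V S n |` dom_infty V S)"
    proof (rule in_l2_prod_closure_of)
      show "f \<in> ell2 V" "g \<in> ell2 V"
        using f[of 0] f[of n] g by auto
      show "Map.graph (op_power V S n |` dom_infty V S) \<subseteq> ell2 V \<times> ell2 V"
        unfolding graph using dom_infty_subset[of \<kappa> lam] by (auto simp: dom_infty_weighted_shift)
      fix e :: real assume "0 < e"
      from truncation[OF f this]
      show "\<exists>(f', g')\<in>Map.graph (op_power V S n |` dom_infty V S). l2_dist f f' < e \<and> l2_dist g g' < e"
        unfolding graph g by auto
    qed
  qed
qed (rule subspace_dom_infty)

text \<open>The hypothesis is paranormality at basis vectors. As energies are sums over vertices,
  Cauchy-Schwarz carries it over to all vectors.\<close>

lemma paranormalI:
  assumes "\<And>u. u \<in> V \<Longrightarrow> (growth \<kappa> lam 1 u)\<^sup>2 \<le> growth \<kappa> lam 2 u"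
  shows "paranormal V S"
  unfolding paranormal_def
proof
  fix f assume "f \<in> dom (op_power V S 2)"
  then have f: "(L ^^ k) f \<in> ell2 V" if "k \<le> 2" for k
    using that by (auto simp: op_power_weighted_shift split: if_splits)
  have e: "ennreal ((l2_norm ((L ^^ k) f))\<^sup>2) = energy (growth \<kappa> lam k) f" if "k \<le> 2" for k
    using ell2_energy_eq[OF f[OF that]] by (simp add: energy_shift_power)
  have "(energy (growth \<kappa> lam 1) f)\<^sup>2 \<le> energy (\<lambda>_. 1) f * energy (growth \<kappa> lam 2) f"
    using f[of 0] by (intro energy_Cauchy_Schwarz assms) (auto simp: ell2_def)
  then have "(ennreal ((l2_norm ((L ^^ 1) f))\<^sup>2))\<^sup>2 \<le> ennreal ((l2_norm ((L ^^ 0) f))\<^sup>2) * ennreal ((l2_norm ((L ^^ 2) f))\<^sup>2)"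
    using e[of 0] e[of 1] e[of 2] by simp
  then have "((l2_norm ((L ^^ 1) f))\<^sup>2)\<^sup>2 \<le> (l2_norm ((L ^^ 0) f) * l2_norm ((L ^^ 2) f))\<^sup>2"
    by (simp add: ennreal_power power_mult_distrib flip: ennreal_mult)
  then have "(l2_norm ((L ^^ 1) f))\<^sup>2 \<le> l2_norm ((L ^^ 0) f) * l2_norm ((L ^^ 2) f)"
    by (rule power2_le_imp_le) (simp add: l2_norm_nonneg)
  then show "(l2_norm (the (S f)))\<^sup>2 \<le> l2_norm f * l2_norm (the (op_power V S 2 f))"
    using f[of 0] f[of 1] f by (simp add: op_power_weighted_shift weighted_shift_def)
qed

end

subsection \<open>Atomic measures\<close>

text \<open>The target \<open>M\<close> is a parameter because S-representing measures live on
  \<open>restrict_space borel {0..}\<close> and H-representing ones on \<open>borel\<close>.\<close>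

definition atoms :: "real measure \<Rightarrow> (nat \<Rightarrow> real) \<Rightarrow> (nat \<Rightarrow> ennreal) \<Rightarrow> real measure" where
  "atoms M x a = distr (density (count_space UNIV) a) M x"

lemma sets_atoms [simp, measurable_cong]: "sets (atoms M x a) = sets M"
  by (simp add: atoms_def)

lemma nn_integral_atoms:
  assumes "\<And>m. x m \<in> space M" "g \<in> borel_measurable M"
  shows "(\<integral>\<^sup>+t. g t \<partial>atoms M x a) = (\<Sum>m. a m * g (x m))"
proof -
  have "x \<in> measurable (density (count_space UNIV) a) M"
    using assms(1) by (simp add: measurable_def)
  then have "(\<integral>\<^sup>+t. g t \<partial>atoms M x a) = (\<integral>\<^sup>+m. g (x m) \<partial>density (count_space UNIV) a)"
    using assms(2) by (simp add: atoms_def nn_integral_distr)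
  also have "\<dots> = (\<Sum>m. a m * g (x m))"
    by (simp add: nn_integral_density nn_integral_count_space_nat)
  finally show ?thesis .
qed

lemma emeasure_atoms:
  assumes "\<And>m. x m \<in> space M" "A \<in> sets M"
  shows "emeasure (atoms M x a) A = (\<Sum>m. a m * indicator A (x m))"
  using nn_integral_atoms[of x M "indicator A" a] assms by simp

lemma AE_atoms:
  assumes "\<And>m. x m \<in> space M" "{t \<in> space M. P t} \<in> sets M" "\<And>m. P (x m)"
  shows "AE t in atoms M x a. P t"
proof -
  have "x \<in> measurable (density (count_space UNIV) a) M"
    using assms(1) by (simp add: measurable_def)
  then show ?thesis
    unfolding atoms_def using assms(2,3) by (subst AE_distr_iff) auto
qed

lemma atoms_moment:
  assumes x: "\<And>m. x m \<in> space M" "\<And>m. 0 \<le> x m" and [measurable]: "(\<lambda>t. t) \<in> borel_measurable M"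
    and "(\<Sum>m. a m * ennreal (x m ^ n)) = ennreal c" "0 \<le> c"
  shows "has_bochner_integral (atoms M x a) (\<lambda>t. t ^ n) c"
proof (rule has_bochner_integral_nn_integral)
  show "AE t in atoms M x a. 0 \<le> t ^ n"
    using x by (intro AE_atoms) auto
  show "(\<integral>\<^sup>+t. ennreal (t ^ n) \<partial>atoms M x a) = ennreal c"
    using x assms(4) by (subst nn_integral_atoms) auto
qed (use assms in auto)

lemma S_representing_atoms:
  assumes "\<And>m. 0 \<le> x m" "\<And>n. (\<Sum>m. a m * ennreal (x m ^ n)) = ennreal (\<gamma> n)" "\<And>n. 0 \<le> \<gamma> n"
  shows "S_representing \<gamma> (atoms (restrict_space borel {0..}) x a)"
  unfolding S_representing_def using assms
  by (auto intro!: atoms_moment simp: space_restrict_space measurable_restrict_space1)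

lemma nn_integral_half_line_atoms:
  assumes "\<And>m. 0 \<le> x m" "g \<in> borel_measurable borel"
  shows "(\<integral>\<^sup>+t. g t \<partial>atoms (restrict_space borel {0..}) x a) = (\<Sum>m. a m * g (x m))"
  using assms by (intro nn_integral_atoms) (auto simp: space_restrict_space measurable_restrict_space1)

subsection \<open>Consistent systems\<close>

lemma half_line_measurable:
  assumes "sets M = sets (restrict_space borel {0..})" "f \<in> borel_measurable borel"
  shows "f \<in> borel_measurable M"
  using measurable_cong_sets[OF assms(1) refl] measurable_restrict_space1[OF assms(2)] by blast

text \<open>Away from 0 the equation says that \<open>M\<close> has density b/t with respect to
  \<open>N\<close>, so the integral of t over \<open>M\<close> is b times the mass that
  \<open>N\<close> gives to the positive reals.\<close>

lemma consistent_mean_le: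
  fixes M N :: "real measure"
  assumes M: "sets M = sets (restrict_space borel {0..})"
    and N: "sets N = sets (restrict_space borel {0..})" "prob_space N"
    and eq: "\<And>A. A \<in> sets (restrict_space borel {0..}) \<Longrightarrow>
      emeasure M A = ennreal b * (\<integral>\<^sup>+t\<in>A. inverse (ennreal t) \<partial>N) + ennreal e * indicator A 0"
    and "0 \<le> b"
  shows "(\<integral>\<^sup>+t. ennreal t \<partial>M) \<le> ennreal b"
proof -
  interpret N: prob_space N by (rule N(2))
  have sp: "space M = {0..}" "space N = {0..}"
    using sets_eq_imp_space_eq[OF M] sets_eq_imp_space_eq[OF N(1)] by (simp_all add: space_restrict_space)
  have pos: "A \<inter> {0<..} \<in> sets (restrict_space borel {0..})" if "A \<in> sets (restrict_space borel {0::real..})" for A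
  proof -
    have "{0<..} \<in> sets (restrict_space borel {0::real..})"
      by (subst sets_restrict_space_iff) auto
    with that show ?thesis by blast
  qed
  \<comment> \<open>Restriction to positive t removes both the atom at 0 and the point where 1/t is
    infinite.\<close>
  define F :: "real \<Rightarrow> ennreal" where "F t = ennreal b * inverse (ennreal t) * indicator {0<..} t" for t
  have "F \<in> borel_measurable borel"
    unfolding F_def by measurable
  then have F: "F \<in> borel_measurable N"
    by (rule half_line_measurable[OF N(1)])
  have "density M (indicator {0<..}) = density N F"
  proof (rule measure_eqI)
    fix A assume "A \<in> sets (density M (indicator {0<..}))"
    then have A: "A \<in> sets M" "A \<in> sets N" "A \<in> sets (restrict_space borel {0..})"
      using M N(1) by auto
    have "emeasure (density M (indicator {0<..})) A = (\<integral>\<^sup>+t. indicator (A \<inter> {0<..}) t \<partial>M)"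
      using A by (subst emeasure_density) (auto intro!: half_line_measurable[OF M] nn_integral_cong simp: indicator_def)
    also have "\<dots> = emeasure M (A \<inter> {0<..})"
      using pos[OF A(3)] M by simp
    also have "\<dots> = ennreal b * (\<integral>\<^sup>+t\<in>A \<inter> {0<..}. inverse (ennreal t) \<partial>N)"
      by (subst eq[OF pos[OF A(3)]]) simp
    also have "\<dots> = (\<integral>\<^sup>+t. ennreal b * (inverse (ennreal t) * indicator (A \<inter> {0<..}) t) \<partial>N)"
      using pos[OF A(3)] N(1)
      by (intro nn_integral_cmult[symmetric] borel_measurable_times_ennreal half_line_measurable[OF N(1)] borel_measurable_indicator)
         auto
    also have "\<dots> = emeasure (density N F) A"
      unfolding emeasure_density[OF F A(2)] by (intro nn_integral_cong) (simp add: F_def indicator_def)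
    finally show "emeasure (density M (indicator {0<..})) A = \<dots>" .
  qed (simp add: M N)
  then have "(\<integral>\<^sup>+t. ennreal t \<partial>density M (indicator {0<..})) =
      (\<integral>\<^sup>+t. ennreal t \<partial>density N F)"
    by simp
  also have "(\<integral>\<^sup>+t. ennreal t \<partial>density M (indicator {0<..})) = (\<integral>\<^sup>+t. indicator {0<..} t * ennreal t \<partial>M)"
    by (intro nn_integral_density half_line_measurable[OF M]) auto
  also have "\<dots> = (\<integral>\<^sup>+t. ennreal t \<partial>M)"
    by (intro nn_integral_cong) (auto simp: indicator_def sp)
  also have "(\<integral>\<^sup>+t. ennreal t \<partial>density N F) =
      (\<integral>\<^sup>+t. F t * ennreal t \<partial>N)"
    by (intro nn_integral_density F half_line_measurable[OF N(1)]) auto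
  also have "\<dots> \<le> (\<integral>\<^sup>+t. ennreal b \<partial>N)"
  proof (rule nn_integral_mono)
    fix t
    show "F t * ennreal t \<le> ennreal b"
      using \<open>0 \<le> b\<close> unfolding F_def by (cases "0 < t") (auto simp: inverse_ennreal field_simps simp flip: ennreal_mult)
  qed
  also have "\<dots> = ennreal b"
    by (simp add: N.emeasure_space_1)
  finally show ?thesis .
qed

text \<open>Integrates the tangent to 1/t at b, that is 1/t \<ge> 2/b - t/b^2, which amounts to (t -
  b)^2 \<ge> 0. The negative term stands on the other side since \<open>ennreal\<close> has no true
  subtraction; at the end the finite 1/b is cancelled.\<close>

lemma Jensen_inverse:
  fixes M :: "real measure"
  assumes M: "sets M = sets (restrict_space borel {0..})" "prob_space M"
    and "(\<integral>\<^sup>+t. ennreal t \<partial>M) \<le> ennreal b" "0 < b"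
  shows "ennreal (1 / b) \<le> (\<integral>\<^sup>+t. inverse (ennreal t) \<partial>M)"
proof -
  interpret prob_space M by (rule M(2))
  have sp: "space M = {0..}"
    using sets_eq_imp_space_eq[OF M(1)] by (simp add: space_restrict_space)
  have *: "ennreal (2 / b) \<le> inverse (ennreal t) + ennreal (1 / b\<^sup>2) * ennreal t" if "0 \<le> t" for t
  proof (cases "t = 0")
    case False
    then have "0 < t" using that by simp
    have "0 \<le> (t - b)\<^sup>2 / (t * b\<^sup>2)"
      using \<open>0 < t\<close> by simp
    also have "(t - b)\<^sup>2 / (t * b\<^sup>2) = inverse t + 1 / b\<^sup>2 * t - 2 / b"
      using \<open>0 < t\<close> \<open>0 < b\<close> by (simp add: field_simps power2_eq_square)
    finally show ?thesis
      using \<open>0 < t\<close> \<open>0 < b\<close> by (simp add: inverse_ennreal flip: ennreal_mult ennreal_plus)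
  qed simp
  have "ennreal (2 / b) = (\<integral>\<^sup>+t. ennreal (2 / b) \<partial>M)"
    by (simp add: emeasure_space_1)
  also have "\<dots> \<le> (\<integral>\<^sup>+t. inverse (ennreal t) + ennreal (1 / b\<^sup>2) * ennreal t \<partial>M)"
    by (intro nn_integral_mono *) (simp add: sp)
  also have "\<dots> = (\<integral>\<^sup>+t. inverse (ennreal t) \<partial>M) + (\<integral>\<^sup>+t. ennreal (1 / b\<^sup>2) * ennreal t \<partial>M)"
    by (intro nn_integral_add half_line_measurable[OF M(1)]) auto
  also have "(\<integral>\<^sup>+t. ennreal (1 / b\<^sup>2) * ennreal t \<partial>M) = ennreal (1 / b\<^sup>2) * (\<integral>\<^sup>+t. ennreal t \<partial>M)"
    by (intro nn_integral_cmult half_line_measurable[OF M(1)]) auto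
  also have "\<dots> \<le> ennreal (1 / b\<^sup>2) * ennreal b"
    by (intro mult_left_mono assms) simp
  also have "\<dots> = ennreal (1 / b)"
    using \<open>0 < b\<close> by (simp add: power2_eq_square flip: ennreal_mult)
  finally have le: "ennreal (2 / b) \<le> (\<integral>\<^sup>+t. inverse (ennreal t) \<partial>M) + ennreal (1 / b)"
    by (simp add: add_left_mono)
  have "ennreal (2 / b) = ennreal (1 / b) + ennreal (1 / b)"
    using \<open>0 < b\<close> by (simp flip: ennreal_plus)
  with le have "ennreal (1 / b) + ennreal (1 / b) \<le> ennreal (1 / b) + (\<integral>\<^sup>+t. inverse (ennreal t) \<partial>M)"
    by (simp only: add.commute)
  then show ?thesis
    by (simp only: ennreal_add_left_cancel_le) simp
qed

text \<open>
  Each branch measure has mean at most \<open>\<bar>\<lambda>\<^bsub>(i,2)\<^esub>\<bar>\<^sup>2\<close>, so by Jensen's inequality its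
  \<open>-1\<close>st moment is at least \<open>1 / \<bar>\<lambda>\<^bsub>(i,2)\<^esub>\<bar>\<^sup>2\<close>.
\<close>

lemma consistent_system_bound:
  assumes "consistent_system \<kappa> lam \<mu> eps" and nz: "\<And>i. lam (Branch (Suc i) 2) \<noteq> 0"
  shows "(\<Sum>i<n. (cmod (lam (Branch (Suc i) 1)) / cmod (lam (Branch (Suc i) 2)))\<^sup>2) \<le> 1"
proof -
  have prob: "sets (\<mu> u) = sets (restrict_space borel {0..})" "prob_space (\<mu> u)" if "u \<in> verts \<kappa>" for u
    using assms(1) that unfolding consistent_system_def by blast+
  have eq: "emeasure (\<mu> u) A = (\<Sum>\<^sub>\<infinity>v\<in>Chi \<kappa> u. ennreal ((cmod (lam v))\<^sup>2) * (\<integral>\<^sup>+t\<in>A. inverse (ennreal t) \<partial>\<mu> v))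
          + ennreal (eps u) * indicator A 0"
    if "u \<in> verts \<kappa>" "A \<in> sets (restrict_space borel {0..})" for u A
    using assms(1) that unfolding consistent_system_def by blast
  define J where "J v = (\<integral>\<^sup>+t\<in>{0..}. inverse (ennreal t) \<partial>\<mu> v)" for v
  have J: "ennreal (1 / (cmod (lam (Branch (Suc i) 2)))\<^sup>2) \<le> J (Branch (Suc i) 1)" for i
  proof -
    have v: "Branch (Suc i) 1 \<in> verts \<kappa>" "Branch (Suc i) 2 \<in> verts \<kappa>"
      by simp_all
    have "(\<integral>\<^sup>+t. ennreal t \<partial>\<mu> (Branch (Suc i) 1)) \<le> ennreal ((cmod (lam (Branch (Suc i) 2)))\<^sup>2)"
    proof (rule consistent_mean_le[OF prob(1)[OF v(1)] prob[OF v(2)]])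
      fix A :: "real set" assume "A \<in> sets (restrict_space borel {0..})"
      then show "emeasure (\<mu> (Branch (Suc i) 1)) A = ennreal ((cmod (lam (Branch (Suc i) 2)))\<^sup>2) *
          (\<integral>\<^sup>+t\<in>A. inverse (ennreal t) \<partial>\<mu> (Branch (Suc i) 2)) + ennreal (eps (Branch (Suc i) 1)) * indicator A 0"
        using eq[OF v(1)] by (simp add: Chi_simps numeral_2_eq_2)
    qed simp
    then have "ennreal (1 / (cmod (lam (Branch (Suc i) 2)))\<^sup>2) \<le> (\<integral>\<^sup>+t. inverse (ennreal t) \<partial>\<mu> (Branch (Suc i) 1))"
      using nz[of i] by (intro Jensen_inverse prob v) auto
    also have "\<dots> = J (Branch (Suc i) 1)"
      using sets_eq_imp_space_eq[OF prob(1)[of "Branch (Suc i) 1"]]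
      unfolding J_def by (intro nn_integral_cong) (auto simp: space_restrict_space indicator_def)
    finally show ?thesis .
  qed
  let ?g = "\<lambda>v. ennreal ((cmod (lam v))\<^sup>2) * J v"
  have "ennreal (\<Sum>i<n. (cmod (lam (Branch (Suc i) 1)) / cmod (lam (Branch (Suc i) 2)))\<^sup>2) =
      (\<Sum>i<n. ennreal ((cmod (lam (Branch (Suc i) 1)))\<^sup>2) * ennreal (1 / (cmod (lam (Branch (Suc i) 2)))\<^sup>2))"
    by (subst sum_ennreal[symmetric]) (auto simp: power_divide simp flip: ennreal_mult)
  also have "\<dots> \<le> (\<Sum>i<n. ?g (Branch (Suc i) 1))"
    by (intro sum_mono mult_left_mono J) auto
  also have "\<dots> = sum ?g ((\<lambda>i. Branch (Suc i) 1) ` {..<n})"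
    by (subst sum.reindex) (auto simp: inj_on_def)
  also have "\<dots> = infsum ?g ((\<lambda>i. Branch (Suc i) 1) ` {..<n})"
    by simp
  also have "\<dots> \<le> infsum ?g (Chi \<kappa> (Trunk 0))"
    by (intro infsum_mono_neutral nonneg_summable_on_complete) (auto simp: Chi_simps)
  \<comment> \<open>Consistency at the branching vertex, tested on the whole half-line with the atom
    term dropped.\<close>
  also have "\<dots> \<le> emeasure (\<mu> (Trunk 0)) {0..}"
    by (subst eq) (auto simp: J_def zero_enat_def[symmetric] sets_restrict_space_iff)
  also have "\<dots> \<le> ennreal 1"
    using prob_space.emeasure_le_1[OF prob(2)] by (simp add: zero_enat_def[symmetric])
  finally show ?thesis
    by (subst (asm) ennreal_le_iff) auto
qed

lemma S_indeterminateI: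
  assumes "S_representing \<gamma> \<mu>" "S_representing \<gamma> \<nu>" "\<mu> \<noteq> \<nu>"
  shows "S_indeterminate \<gamma>"
  using assms unfolding S_indeterminate_def Stieltjes_moment_sequence_def by blast

section \<open>Adjoints tested on basis vectors\<close>

lemma infsum_eq_sum:
  assumes "finite F" "\<And>v. v \<notin> F \<Longrightarrow> f v = 0"
  shows "(\<Sum>\<^sub>\<infinity>v. f v) = sum f F"
proof -
  have "(\<Sum>\<^sub>\<infinity>v. f v) = infsum f F"
    using assms(2) by (intro infsum_cong_neutral) auto
  then show ?thesis
    using assms(1) by simp
qed

lemma l2_inner_basis_vec: "l2_inner (basis_vec u) h = cnj (h u)"
  unfolding l2_inner_def by (subst infsum_eq_sum[of "{u}"]) (auto simp: basis_vec_def)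

text \<open>Testing against the basis vectors determines each coordinate of the adjoint vector, so
  the definite description in \<open>adjoint_op\<close> denotes.\<close>

lemma adjoint_opE:
  assumes "f \<in> dom (adjoint_op V A)" and basis: "\<And>u. u \<in> V \<Longrightarrow> basis_vec u \<in> dom A"
  shows "the (adjoint_op V A f) \<in> ell2 V"
    and "\<And>g. g \<in> dom A \<Longrightarrow> l2_inner (the (A g)) f = l2_inner g (the (adjoint_op V A f))"
proof -
  define P where "P h \<longleftrightarrow> h \<in> ell2 V \<and> (\<forall>g\<in>dom A. l2_inner (the (A g)) f = l2_inner g h)" for h
  have cond: "f \<in> ell2 V \<and> (\<exists>h\<in>ell2 V. \<forall>g\<in>dom A. l2_inner (the (A g)) f = l2_inner g h)"
    using assms(1) unfolding dom_def adjoint_op_def mem_Collect_eq by meson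
  then obtain h where h: "P h"
    unfolding P_def by blast
  have unique: "h' = h" if "P h'" for h'
  proof
    fix u
    show "h' u = h u"
    proof (cases "u \<in> V")
      case True
      then have "l2_inner (basis_vec u) h' = l2_inner (basis_vec u) h"
        using that h basis by (auto simp: P_def)
      then show ?thesis
        by (simp add: l2_inner_basis_vec)
    qed (use that h in \<open>auto simp: P_def ell2_def\<close>)
  qed
  have "the (adjoint_op V A f) = (THE h. P h)"
    unfolding adjoint_op_def P_def if_P[OF cond] by simp
  moreover have "P (THE h. P h)"
    using h unique by (rule theI)
  ultimately show "the (adjoint_op V A f) \<in> ell2 V"
    and "\<And>g. g \<in> dom A \<Longrightarrow> l2_inner (the (A g)) f = l2_inner g (the (adjoint_op V A f))"
    by (auto simp: P_def)
qed

subsection \<open>Weights from two measures with equal moments\<close>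

text \<open>
  The measure \<open>\<nu> = \<Sum>\<^sub>i w\<^sub>i \<delta>\<^bsub>x (p i)\<^esub>\<close> determines the weights on the branches, and
  \<open>\<rho> = \<Sum>\<^sub>m r\<^sub>m \<delta>\<^bsub>x m\<^esub>\<close> those on the trunk. As \<open>\<rho>\<close> and \<open>\<nu>\<close> have equal moments,
  \<open>\<parallel>S\<^sup>n\<^sup>+\<^sup>1e\<^sub>0\<parallel>\<^sup>2\<close> is the \<open>n\<close>th moment of either.
\<close>

locale branching_data =
  fixes \<kappa> :: enat and x r w :: "nat \<Rightarrow> real" and p :: "nat \<Rightarrow> nat"
  assumes x_ge_1: "1 \<le> x m"
    and r_nonneg: "0 \<le> r m"
    and w_pos: "0 < w i"
    and r_summable: "summable (\<lambda>m. r m * x m ^ n)"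
    and moments_eq: "(\<lambda>i. w i * x (p i) ^ n) sums (\<Sum>m. r m * x m ^ n)"
    and r_inverse: "(\<Sum>m. r m / x m) = 1"
    and w_inverse: "1 < (\<Sum>i. w i / x (p i))"
begin

text \<open>The offset makes this the normalising constant of the measure at the vertex -k; for k =
  0 it is 1 by \<open>r_inverse\<close>.\<close>

definition inverse_moment :: "nat \<Rightarrow> real" where
  "inverse_moment k = (\<Sum>m. r m / x m ^ Suc k)"

text \<open>The weight at \<open>x m\<close> of the probability measure representing ||S^n e_v||^2.
  Branches are numbered from 1 but \<open>w\<close> and \<open>p\<close> from 0, hence
  \<open>i - 1\<close>.\<close>

definition mass :: "vertex \<Rightarrow> nat \<Rightarrow> real" where
  "mass v m = (case v of Trunk k \<Rightarrow> r m / x m ^ Suc k / inverse_moment k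
     | Branch i j \<Rightarrow> if m = p (i - 1) then 1 else 0)"

definition moment :: "vertex \<Rightarrow> nat \<Rightarrow> real" where
  "moment v n = (\<Sum>m. mass v m * x m ^ n)"

text \<open>On the trunk the squared weight is the quotient of consecutive normalising constants,
  which is the first moment at the parent.\<close>

definition weight :: "vertex \<Rightarrow> real" where
  "weight v = (case v of Trunk k \<Rightarrow> sqrt (inverse_moment k / inverse_moment (Suc k))
     | Branch i j \<Rightarrow> if j = 1 then sqrt (w (i - 1)) else sqrt (x (p (i - 1))))"

lemma x_pos: "0 < x m"
  using x_ge_1[of m] by linarith

text \<open>Atoms in [1,\<infinity>) make every negative moment finite; this permits trunks of any
  length.\<close>

lemma summable_inverse: "summable (\<lambda>m. r m / x m ^ k)"
proof (rule summable_comparison_test')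
  show "summable r"
    using r_summable[of 0] by simp
  fix m
  have "r m / x m ^ k \<le> r m / 1"
    using r_nonneg[of m] x_ge_1[of m] by (intro divide_left_mono) auto
  then show "norm (r m / x m ^ k) \<le> r m"
    using r_nonneg[of m] x_pos[of m] by simp
qed

lemma summable_w_inverse: "summable (\<lambda>i. w i / x (p i))"
proof (rule summable_comparison_test')
  show "summable w"
    using sums_summable[OF moments_eq[of 0]] by simp
  fix i
  have "w i / x (p i) \<le> w i / 1"
    using w_pos[of i] x_ge_1[of "p i"] by (intro divide_left_mono) auto
  then show "norm (w i / x (p i)) \<le> w i"
    using w_pos[of i] x_pos[of "p i"] by simp
qed

lemma inverse_moment_0: "inverse_moment 0 = 1"
  using r_inverse by (simp add: inverse_moment_def)

lemma inverse_moment_pos: "0 < inverse_moment k"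
proof -
  have "\<exists>m. r m \<noteq> 0"
    using r_inverse by (rule contrapos_pp) simp
  then obtain m where "0 < r m"
    using r_nonneg by (metis less_eq_real_def)
  then show ?thesis
    unfolding inverse_moment_def using x_pos r_nonneg
    by (intro suminf_pos2[OF summable_inverse[of "Suc k"], of m]) (auto intro: divide_nonneg_pos)
qed

lemma mass_nonneg: "0 \<le> mass v m"
  using r_nonneg[of m] x_pos[of m] inverse_moment_pos
  by (cases v) (auto simp: mass_def intro!: divide_nonneg_pos zero_less_power)

lemma sums_branch: "(\<lambda>m. mass (Branch i j) m * x m ^ n) sums (x (p (i - 1)) ^ n)"
proof -
  have "mass (Branch i j) m * x m ^ n = (if m = p (i - 1) then x m ^ n else 0)" for m
    by (simp add: mass_def)
  then show ?thesis
    using sums_single[of "p (i - 1)" "\<lambda>m. x m ^ n"] by (simp only:)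
qed

lemma summable_moment: "summable (\<lambda>m. mass v m * x m ^ n)"
proof (cases v)
  case (Trunk k)
  show ?thesis
  proof (rule summable_comparison_test')
    show "summable (\<lambda>m. r m * x m ^ n / inverse_moment k)"
      by (intro summable_divide r_summable)
    fix m
    have "r m * x m ^ n / x m ^ Suc k \<le> r m * x m ^ n / 1"
      using r_nonneg[of m] x_ge_1[of m] x_pos[of m] by (intro divide_left_mono one_le_power) auto
    then have "r m * x m ^ n / x m ^ Suc k / inverse_moment k \<le> r m * x m ^ n / inverse_moment k"
      using inverse_moment_pos[of k] by (intro divide_right_mono) auto
    moreover have "0 \<le> mass v m * x m ^ n"
      using mass_nonneg[of v m] x_pos[of m] by simp
    ultimately show "norm (mass v m * x m ^ n) \<le> r m * x m ^ n / inverse_moment k"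
      by (simp add: mass_def Trunk)
  qed
qed (use sums_branch in \<open>auto dest: sums_summable\<close>)

lemma moment_branch: "moment (Branch i j) n = x (p (i - 1)) ^ n"
  using sums_branch by (simp add: moment_def sums_iff)

lemma moment_nonneg: "0 \<le> moment v n"
  unfolding moment_def using mass_nonneg x_pos
  by (intro suminf_nonneg summable_moment) (simp add: less_imp_le)

lemma moment_ennreal: "(\<Sum>m. ennreal (mass v m) * ennreal (x m ^ n)) = ennreal (moment v n)"
proof -
  have "(\<Sum>m. ennreal (mass v m * x m ^ n)) = ennreal (moment v n)"
    unfolding moment_def using mass_nonneg x_pos
    by (intro suminf_ennreal2 summable_moment) (simp add: less_imp_le)
  then show ?thesis
    using mass_nonneg x_pos by (simp add: ennreal_mult less_imp_le)
qed

lemma moment_0: "moment v 0 = 1"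
proof (cases v)
  case (Trunk k)
  have "(\<Sum>m. r m / x m ^ Suc k / inverse_moment k) = inverse_moment k / inverse_moment k"
    unfolding inverse_moment_def by (rule suminf_divide) (rule summable_inverse)
  then show ?thesis
    using inverse_moment_pos[of k] by (simp add: moment_def mass_def Trunk)
qed (simp add: moment_branch)

lemma moment_root: "moment (Trunk 0) (Suc n) = (\<Sum>m. r m * x m ^ n)"
  unfolding moment_def mass_def using x_pos
  by (intro arg_cong[where f = suminf] ext) (simp add: inverse_moment_0 less_imp_neq[symmetric])

lemma moment_trunk:
  "moment (Trunk (Suc k)) (Suc n) = inverse_moment k / inverse_moment (Suc k) * moment (Trunk k) n"
proof -
  have "mass (Trunk (Suc k)) m * x m ^ Suc n =
      inverse_moment k / inverse_moment (Suc k) * (mass (Trunk k) m * x m ^ n)" for m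
    using inverse_moment_pos[of k] inverse_moment_pos[of "Suc k"] x_pos[of m]
    by (simp add: mass_def field_simps)
  then show ?thesis
    unfolding moment_def by (simp only: suminf_mult[OF summable_moment])
qed

lemma growth_eq:
  assumes "u \<in> verts \<kappa>"
  shows "growth \<kappa> (\<lambda>v. complex_of_real (weight v)) n u = ennreal (moment u n)"
  using assms
proof (induction n arbitrary: u)
  case 0
  then show ?case by (simp add: moment_0)
next
  case (Suc n)
  let ?g = "\<lambda>v. ennreal ((weight v)\<^sup>2) * growth \<kappa> (\<lambda>v. complex_of_real (weight v)) n v"
  have g: "?g v = ennreal ((weight v)\<^sup>2 * moment v n)" if "v \<in> verts \<kappa>" for v
    using Suc.IH[OF that] by (simp add: ennreal_mult moment_nonneg)
  show ?case
  proof (cases u)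
    case (Branch i j)
    then have ij: "1 \<le> i" "1 \<le> j"
      using Suc.prems by auto
    have "growth \<kappa> (\<lambda>v. complex_of_real (weight v)) (Suc n) u = ?g (Branch i (Suc j))"
      using ij by (simp add: Branch Chi_simps nn_integral_count_space_finite)
    also have "\<dots> = ennreal (moment u (Suc n))"
      using ij x_pos[of "p (i - 1)"] by (subst g) (auto simp: Branch weight_def moment_branch)
    finally show ?thesis .
  next
    case (Trunk k)
    show ?thesis
    proof (cases k)
      case 0
      have inj: "inj (\<lambda>i. Branch (Suc i) (Suc 0))"
        by (auto simp: inj_on_def)
      have "growth \<kappa> (\<lambda>v. complex_of_real (weight v)) (Suc n) u =
          (\<integral>\<^sup>+v. ?g v \<partial>count_space (range (\<lambda>i. Branch (Suc i) (Suc 0))))"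
        by (simp add: Trunk 0 Chi_simps)
      also have "\<dots> = (\<Sum>i. ?g (Branch (Suc i) (Suc 0)))"
        using nn_integral_bij_count_space[OF inj_on_imp_bij_betw[OF inj], of ?g]
        by (simp add: nn_integral_count_space_nat)
      also have "\<dots> = (\<Sum>i. ennreal (w i * x (p i) ^ n))"
        using w_pos by (subst g) (auto simp: weight_def moment_branch less_imp_le)
      also have "\<dots> = ennreal (\<Sum>i. w i * x (p i) ^ n)"
        using w_pos x_pos moments_eq
        by (intro suminf_ennreal2) (auto simp: less_imp_le sums_iff)
      \<comment> \<open>The children of the branching vertex produce a moment of \<nu>, while the
        measure at this vertex was built from \<rho>; \<open>moments_eq\<close> reconciles
        them.\<close>
      also have "\<dots> = ennreal (moment u (Suc n))"
        using moments_eq[of n] by (simp add: Trunk 0 moment_root sums_iff)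
      finally show ?thesis .
    next
      case (Suc l)
      then have l: "enat (Suc l) \<le> \<kappa>" "enat l \<le> \<kappa>"
        using Suc.prems Trunk by (auto intro: order_trans[of "enat l" "enat (Suc l)"])
      have "growth \<kappa> (\<lambda>v. complex_of_real (weight v)) (Suc n) u = ?g (Trunk l)"
        using l by (simp add: Trunk Suc Chi_simps nn_integral_count_space_finite)
      also have "\<dots> = ennreal (moment u (Suc n))"
        using l inverse_moment_pos[of l] inverse_moment_pos[of "Suc l"]
        by (subst g) (auto simp: Trunk Suc weight_def moment_trunk)
      finally show ?thesis .
    qed
  qed
qed

sublocale finite_growth \<kappa> "\<lambda>v. complex_of_real (weight v)"
  by unfold_locales (simp add: growth_eq)

section \<open>Verification of the required properties\<close>

lemma norm_power_seq_basis_vec: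
  assumes "u \<in> V"
  shows "norm_power_seq V S (basis_vec u) n = moment u n"
proof -
  have "ennreal (norm_power_seq V S (basis_vec u) n) = ennreal (moment u n)"
    using norm_power_seq_weighted_shift[OF basis_vec_dom_infty[OF assms]] assms
    by (simp add: energy_basis_vec growth_eq)
  then show ?thesis
    by (simp add: moment_nonneg norm_power_seq_def)
qed

lemma root_in_V: "Trunk 0 \<in> V"
  by (simp add: zero_enat_def[symmetric])

lemma weight_pos: "0 < weight v"
  using inverse_moment_pos w_pos x_pos by (cases v) (auto simp: weight_def)

lemma paranormal_shift: "paranormal V S"
proof (rule paranormalI)
  fix u assume u: "u \<in> V"
  \<comment> \<open>Square roots of the masses turn integrals over the measure at \<open>u\<close>
    into energies, so the inequality is Cauchy-Schwarz for a probability measure.\<close>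
  define f where "f m = complex_of_real (sqrt (mass u m))" for m
  have e: "energy (\<lambda>m. ennreal (x m ^ n)) f = growth \<kappa> (\<lambda>v. complex_of_real (weight v)) n u" for n
    using u mass_nonneg[of u] by (simp add: energy_def f_def nn_integral_count_space_nat growth_eq moment_ennreal)
  have "(energy (\<lambda>m. ennreal (x m ^ 1)) f)\<^sup>2 \<le> energy (\<lambda>_. 1) f * energy (\<lambda>m. ennreal (x m ^ 2)) f"
    using x_pos by (intro energy_Cauchy_Schwarz) (simp add: ennreal_power less_imp_le)
  also have "energy (\<lambda>_. 1) f = 1"
    using e[of 0] by simp
  finally show "(growth \<kappa> (\<lambda>v. complex_of_real (weight v)) 1 u)\<^sup>2 \<le> growth \<kappa> (\<lambda>v. complex_of_real (weight v)) 2 u"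
    unfolding e by simp
qed

lemma generates_Stieltjes_shift: "generates_Stieltjes V S"
  unfolding generates_Stieltjes_def
proof (intro conjI ballI)
  fix f assume f: "f \<in> dom_infty V S"
  have f0: "f v = 0" if "v \<notin> V" for v
    using f dom_infty_subset that by (auto simp: ell2_def)
  \<comment> \<open>The representing measure is the sum of the vertex measures weighted by |f(v)|^2;
    as they share their atoms, only the masses need adding.\<close>
  define a where "a m = (\<integral>\<^sup>+v. ennreal ((cmod (f v))\<^sup>2) * ennreal (mass v m) \<partial>count_space UNIV)" for m
  have "(\<Sum>m. a m * ennreal (x m ^ n)) = ennreal (norm_power_seq V S f n)" for n
  proof -
    have "ennreal (norm_power_seq V S f n) =
        (\<integral>\<^sup>+v. ennreal ((cmod (f v))\<^sup>2) * growth \<kappa> (\<lambda>v. complex_of_real (weight v)) n v \<partial>count_space UNIV)"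
      using norm_power_seq_weighted_shift[OF f] by (simp add: energy_def)
    also have "\<dots> = (\<integral>\<^sup>+v. (\<Sum>m. ennreal ((cmod (f v))\<^sup>2) * (ennreal (mass v m) * ennreal (x m ^ n))) \<partial>count_space UNIV)"
    proof (rule nn_integral_cong)
      fix v
      show "ennreal ((cmod (f v))\<^sup>2) * growth \<kappa> (\<lambda>v. complex_of_real (weight v)) n v =
          (\<Sum>m. ennreal ((cmod (f v))\<^sup>2) * (ennreal (mass v m) * ennreal (x m ^ n)))"
        by (cases "v \<in> V") (auto simp: f0 growth_eq moment_ennreal)
    qed
    also have "\<dots> = (\<Sum>m. \<integral>\<^sup>+v. ennreal ((cmod (f v))\<^sup>2) * (ennreal (mass v m) * ennreal (x m ^ n)) \<partial>count_space UNIV)"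
      by (rule nn_integral_suminf) simp
    also have "\<dots> = (\<Sum>m. a m * ennreal (x m ^ n))"
      by (simp add: a_def mult.assoc flip: nn_integral_multc)
    finally show ?thesis ..
  qed
  then have "S_representing (norm_power_seq V S f) (atoms (restrict_space borel {0..}) x a)"
    using x_pos by (intro S_representing_atoms) (auto simp: norm_power_seq_def less_imp_le)
  then show "Stieltjes_moment_sequence (norm_power_seq V S f)"
    unfolding Stieltjes_moment_sequence_def by blast
qed (rule dense_dom_infty)

lemma suminf_inverse_branch:
  "(\<Sum>m. ennreal (mass (Branch i j) m) * inverse (ennreal (x m))) = ennreal (1 / x (p (i - 1)))"
proof -
  have "(\<lambda>m. mass (Branch i j) m * (1 / x m)) sums (1 / x (p (i - 1)))"
  proof -
    have "mass (Branch i j) m * (1 / x m) = (if m = p (i - 1) then 1 / x m else 0)" for m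
      by (simp add: mass_def)
    then show ?thesis
      using sums_single[of "p (i - 1)" "\<lambda>m. 1 / x m"] by (simp only:)
  qed
  then have "(\<Sum>m. ennreal (mass (Branch i j) m * (1 / x m))) = ennreal (1 / x (p (i - 1)))"
    using mass_nonneg x_pos by (subst suminf_ennreal2) (auto simp: sums_iff less_imp_le)
  moreover have "ennreal (mass (Branch i j) m * (1 / x m)) = ennreal (mass (Branch i j) m) * inverse (ennreal (x m))" for m
    using mass_nonneg[of "Branch i j" m] x_pos[of m]
    by (subst ennreal_mult) (auto simp: inverse_ennreal inverse_eq_divide)
  ultimately show ?thesis by simp
qed

lemma violates_consistency: "violates_consistency_at_0 \<kappa> (\<lambda>v. complex_of_real (weight v))"
proof -
  define \<mu> where "\<mu> i = atoms (restrict_space borel {0..}) x (\<lambda>m. ennreal (mass (Branch i 1) m))" for i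
  have "S_representing (norm_power_seq V S (basis_vec (Branch i 1))) (\<mu> i)" if "1 \<le> i" for i
    unfolding \<mu>_def using that x_pos
    by (intro S_representing_atoms) (auto simp: norm_power_seq_basis_vec moment_ennreal moment_nonneg less_imp_le)
  moreover have "(\<integral>\<^sup>+t. inverse (ennreal t) \<partial>\<mu> i) = ennreal (1 / x (p (i - 1)))" for i
    unfolding \<mu>_def using x_pos by (subst nn_integral_half_line_atoms) (auto simp: suminf_inverse_branch less_imp_le)
  moreover have "(\<Sum>i. ennreal ((weight (Branch (Suc i) 1))\<^sup>2) * ennreal (1 / x (p i))) = ennreal (\<Sum>i. w i / x (p i))"
  proof -
    have "(\<Sum>i. ennreal ((weight (Branch (Suc i) 1))\<^sup>2) * ennreal (1 / x (p i))) = (\<Sum>i. ennreal (w i / x (p i)))"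
      using w_pos x_pos by (simp add: weight_def less_imp_le flip: ennreal_mult)
    also have "\<dots> = ennreal (\<Sum>i. w i / x (p i))"
      using w_pos x_pos by (intro suminf_ennreal2 summable_w_inverse) (simp add: less_imp_le)
    finally show ?thesis .
  qed
  ultimately show ?thesis
    unfolding violates_consistency_at_0_def using w_inverse
    by (intro exI[of _ \<mu>]) (auto simp: basis_vec_dom_infty)
qed

text \<open>Finitely many branches already violate the bound, which gives the non-hyponormality
  witness finite support.\<close>

lemma partial_sum_gt_1: "\<exists>n. 1 < (\<Sum>i<n. w i / x (p i))"
proof -
  have "\<forall>\<^sub>F n in sequentially. 1 < (\<Sum>i<n. w i / x (p i))"
    using summable_LIMSEQ[OF summable_w_inverse] w_inverse by (rule order_tendstoD)
  then show ?thesis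
    by (auto simp: eventually_sequentially)
qed

lemma no_consistent_system: "\<not> consistent_system \<kappa> (\<lambda>v. complex_of_real (weight v)) \<mu> eps"
proof
  assume cs: "consistent_system \<kappa> (\<lambda>v. complex_of_real (weight v)) \<mu> eps"
  obtain n where "1 < (\<Sum>i<n. w i / x (p i))"
    using partial_sum_gt_1 by blast
  \<comment> \<open>The second weight on a branch has square \<open>x (p i)\<close>, so these are
    the quotients that a consistent system bounds.\<close>
  also have "\<dots> = (\<Sum>i<n. (cmod (complex_of_real (weight (Branch (Suc i) 1))) / cmod (complex_of_real (weight (Branch (Suc i) 2))))\<^sup>2)"
    using w_pos x_pos by (intro sum.cong) (auto simp: weight_def power_divide less_imp_le)
  also have "\<dots> \<le> 1"
    by (rule consistent_system_bound[OF cs]) (simp add: weight_pos less_imp_neq[symmetric])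
  finally show False by simp
qed

text \<open>The witness is \<open>f = \<Sum>\<^sub>i (\<lambda>\<^bsub>(i,1)\<^esub> / \<theta>\<^sub>i) e\<^bsub>(i,1)\<^esub>\<close>, a finite sum, where \<open>\<theta>\<^sub>i = \<parallel>S e\<^bsub>(i,1)\<^esub>\<parallel>\<^sup>2\<close>.\<close>

lemma not_hyponormal: "\<not> hyponormal V S"
proof
  assume hyp: "hyponormal V S"
  obtain n where n: "1 < (\<Sum>i<n. w i / x (p i))"
    using partial_sum_gt_1 by blast
  define s where "s = (\<Sum>i<n. w i / x (p i))"
  define b where "b i = Branch (Suc i) 1" for i
  define F where "F = b ` {..<n}"
  define q where "q v = (case v of Branch i j \<Rightarrow> complex_of_real (sqrt (w (i - 1)) / x (p (i - 1))) | _ \<Rightarrow> 0)" for v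
  define f where "f v = (if v \<in> F then q v else 0)" for v
  have F: "finite F" "F \<subseteq> V"
    by (auto simp: F_def b_def)
  have sum_F: "sum g F = (\<Sum>i<n. g (b i))" for g :: "vertex \<Rightarrow> 'c :: comm_monoid_add"
    unfolding F_def by (subst sum.reindex) (auto simp: b_def inj_on_def)
  have "(\<lambda>v. if v \<in> F then f v else 0) = f"
    by (auto simp: f_def)
  moreover have "f v = 0" if "v \<notin> V" for v
    using that F(2) by (auto simp: f_def)
  ultimately have f: "f \<in> dom_infty V S"
    using finite_support_dom_infty[OF F(1), of f] by simp
  have dom: "g \<in> dom S \<and> the (S g) = L g \<and> L g \<in> ell2 V" if "g \<in> dom_infty V S" for g
  proof -
    have "(L ^^ 0) g \<in> ell2 V" "(L ^^ 1) g \<in> ell2 V"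
      using that by (auto simp only: dom_infty_weighted_shift mem_Collect_eq)
    then show ?thesis
      by (auto simp: weighted_shift_def)
  qed
  have "ennreal ((l2_norm (L f))\<^sup>2) = energy (\<lambda>_. 1) (L f)"
    using dom[OF f] by (intro ell2_energy_eq[symmetric]) blast
  also have "\<dots> = energy (growth \<kappa> (\<lambda>v. complex_of_real (weight v)) 1) (\<lambda>v. if v \<in> F then q v else 0)"
    using energy_shift_power[where n = 1 and f = f] by (simp add: f_def[abs_def])
  also have "\<dots> = (\<Sum>i<n. ennreal ((cmod (q (b i)))\<^sup>2) * growth \<kappa> (\<lambda>v. complex_of_real (weight v)) 1 (b i))"
    unfolding energy_finite_supp[OF F(1)] sum_F ..
  also have "\<dots> = (\<Sum>i<n. ennreal (w i / x (p i)))"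
  proof (rule sum.cong)
    fix i
    have "growth \<kappa> (\<lambda>v. complex_of_real (weight v)) 1 (b i) = ennreal (x (p i))"
      by (subst growth_eq) (auto simp: b_def moment_branch)
    moreover have "(cmod (q (b i)))\<^sup>2 = w i / (x (p i))\<^sup>2"
      using w_pos[of i] x_pos[of "p i"] by (simp add: q_def b_def power_divide norm_divide)
    moreover have "w i / (x (p i))\<^sup>2 * x (p i) = w i / x (p i)"
      using x_pos[of "p i"] by (simp add: power2_eq_square)
    ultimately show "ennreal ((cmod (q (b i)))\<^sup>2) * growth \<kappa> (\<lambda>v. complex_of_real (weight v)) 1 (b i) = ennreal (w i / x (p i))"
      using w_pos[of i] x_pos[of "p i"] by (simp flip: ennreal_mult)
  qed simp
  also have "\<dots> = ennreal s"
    unfolding s_def using w_pos x_pos by (intro sum_ennreal) (simp add: less_imp_le)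
  finally have norm_Lf: "(l2_norm (L f))\<^sup>2 = s"
    using n by (simp add: s_def)
  \<comment> \<open>Pairing with \<open>e_0\<close> gives the adjoint vector the coordinate s at 0.
    Hyponormality would then yield s \<le> ||S f|| with ||S f||^2 = s, impossible for s > 1.\<close>
  define h where "h = the (adjoint_op V S f)"
  have "f \<in> dom (adjoint_op V S)"
    using hyp dom[OF f] by (auto simp: hyponormal_def)
  note adj = adjoint_opE[OF this, folded h_def, OF _]
  have h: "h \<in> ell2 V" "l2_inner (L (basis_vec (Trunk 0))) f = l2_inner (basis_vec (Trunk 0)) h"
    using adj(1) adj(2)[of "basis_vec (Trunk 0)"] dom[OF basis_vec_dom_infty[OF root_in_V]]
      dom[OF basis_vec_dom_infty] by auto
  have "cnj (h (Trunk 0)) = (\<Sum>\<^sub>\<infinity>v. L (basis_vec (Trunk 0)) v * cnj (f v))"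
    using h(2) by (simp add: l2_inner_basis_vec) (simp add: l2_inner_def)
  also have "\<dots> = (\<Sum>v\<in>F. L (basis_vec (Trunk 0)) v * cnj (f v))"
    by (rule infsum_eq_sum[OF F(1)]) (simp add: f_def)
  also have "\<dots> = (\<Sum>i<n. complex_of_real (w i / x (p i)))"
    unfolding sum_F
  proof (rule sum.cong)
    fix i assume "i \<in> {..<n}"
    then have "f (b i) = complex_of_real (sqrt (w i) / x (p i))"
      by (simp add: f_def F_def q_def b_def)
    moreover have "L (basis_vec (Trunk 0)) (b i) = complex_of_real (sqrt (w i))"
      by (simp add: b_def shift_map_def basis_vec_def weight_def)
    ultimately show "L (basis_vec (Trunk 0)) (b i) * cnj (f (b i)) = complex_of_real (w i / x (p i))"
      using w_pos[of i] by (simp flip: of_real_mult)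
  qed simp
  finally have "cnj (h (Trunk 0)) = complex_of_real s"
    by (simp add: s_def)
  then have "cmod (h (Trunk 0)) = s"
    using n by (metis abs_of_pos complex_mod_cnj less_trans norm_of_real s_def zero_less_one)
  then have "s \<le> l2_norm h"
    using L2_set_le_l2_norm[OF h(1), of "{Trunk 0}"] by simp
  also have "\<dots> \<le> l2_norm (L f)"
    using hyp dom[OF f] unfolding hyponormal_def h_def by metis
  finally have "s\<^sup>2 \<le> (l2_norm (L f))\<^sup>2"
    using n by (intro power_mono) (auto simp: s_def)
  then have "s * s \<le> s"
    unfolding norm_Lf by (simp add: power2_eq_square)
  moreover have "1 * s < s * s"
    using n by (intro mult_strict_right_mono) (auto simp: s_def)
  ultimately show False
    by simp
qed

text \<open>Both \<rho> and \<nu> represent the sequence, and the integral of 1/x tells them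
  apart.\<close>

lemma S_indeterminate_shifted: "S_indeterminate (\<lambda>n. norm_power_seq V S (basis_vec (Trunk 0)) (n + 1))"
proof -
  define \<rho> where "\<rho> = atoms (restrict_space borel {0..}) x (\<lambda>m. ennreal (r m))"
  define \<nu> where "\<nu> = atoms (restrict_space borel {0..}) (\<lambda>i. x (p i)) (\<lambda>i. ennreal (w i))"
  have seq: "norm_power_seq V S (basis_vec (Trunk 0)) (n + 1) = (\<Sum>m. r m * x m ^ n)" for n
    using norm_power_seq_basis_vec[OF root_in_V] by (simp add: moment_root)
  have nonneg: "0 \<le> (\<Sum>m. r m * x m ^ n)" for n
    using r_nonneg x_pos by (intro suminf_nonneg r_summable) (simp add: less_imp_le)
  have "(\<Sum>m. ennreal (r m) * ennreal (x m ^ n)) = ennreal (\<Sum>m. r m * x m ^ n)" for n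
    using r_nonneg x_pos by (subst suminf_ennreal2[symmetric, OF _ r_summable]) (auto simp: ennreal_mult less_imp_le)
  then have "S_representing (\<lambda>n. norm_power_seq V S (basis_vec (Trunk 0)) (n + 1)) \<rho>"
    unfolding seq \<rho>_def using x_pos nonneg by (intro S_representing_atoms) (auto simp: less_imp_le)
  moreover have "(\<Sum>i. ennreal (w i) * ennreal (x (p i) ^ n)) = ennreal (\<Sum>m. r m * x m ^ n)" for n
  proof -
    have "(\<Sum>i. ennreal (w i * x (p i) ^ n)) = ennreal (\<Sum>m. r m * x m ^ n)"
      using moments_eq[of n] w_pos x_pos by (subst suminf_ennreal2) (auto simp: sums_iff less_imp_le)
    then show ?thesis
      using w_pos x_pos by (simp add: ennreal_mult less_imp_le)
  qed
  then have "S_representing (\<lambda>n. norm_power_seq V S (basis_vec (Trunk 0)) (n + 1)) \<nu>"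
    unfolding seq \<nu>_def using x_pos nonneg by (intro S_representing_atoms) (auto simp: less_imp_le)
  moreover have "\<rho> \<noteq> \<nu>"
  proof
    assume "\<rho> = \<nu>"
    have "(\<integral>\<^sup>+t. inverse (ennreal t) \<partial>\<rho>) = (\<Sum>m. ennreal (r m / x m))"
      unfolding \<rho>_def using x_pos r_nonneg
      by (subst nn_integral_half_line_atoms) (auto simp: inverse_ennreal less_imp_le divide_inverse ennreal_mult)
    also have "\<dots> = ennreal (\<Sum>m. r m / x m)"
      using summable_inverse[of 1] r_nonneg x_pos
      by (intro suminf_ennreal2) (auto intro: divide_nonneg_pos)
    also have "\<dots> = ennreal 1"
      by (simp add: r_inverse)
    finally have 1: "(\<integral>\<^sup>+t. inverse (ennreal t) \<partial>\<rho>) = ennreal 1" .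
    have "(\<integral>\<^sup>+t. inverse (ennreal t) \<partial>\<nu>) = (\<Sum>i. ennreal (w i / x (p i)))"
      unfolding \<nu>_def using x_pos w_pos
      by (subst nn_integral_half_line_atoms) (auto simp: inverse_ennreal less_imp_le divide_inverse ennreal_mult)
    also have "\<dots> = ennreal (\<Sum>i. w i / x (p i))"
      using w_pos x_pos by (intro suminf_ennreal2 summable_w_inverse) (simp add: less_imp_le)
    finally show False
      using 1 \<open>\<rho> = \<nu>\<close> w_inverse by simp
  qed
  ultimately show ?thesis
    by (rule S_indeterminateI)
qed

lemma counterexample_weights_weight: "counterexample_weights \<kappa> weight"
  unfolding counterexample_weights_def Let_def
  using weight_pos closed_weighted_shift paranormal_shift not_hyponormal generates_Stieltjes_shift
    core_dom_infty violates_consistency no_consistent_system basis_vec_dom_infty[OF root_in_V]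
    S_indeterminate_shifted
  by blast

lemma norm_power_seq_root: "norm_power_seq V S (basis_vec (Trunk 0)) n = (\<Sum>m. r m / x m * x m ^ n)"
  using norm_power_seq_basis_vec[OF root_in_V] by (simp add: moment_def mass_def inverse_moment_0)

end

subsection \<open>A determinacy criterion\<close>

text \<open>Integrals of polynomials depend only on the moments, so for any representing measure
  they can be computed on the atoms \<open>y k\<close>.\<close>

lemma H_representing_poly_square:
  fixes q :: "real poly"
  assumes summ: "\<And>n. summable (\<lambda>k. b k * y k ^ n)"
    and rep: "H_representing (\<lambda>n. \<Sum>k. b k * y k ^ n) \<gamma>"
  shows "(\<integral>\<^sup>+t. ennreal ((poly q t)\<^sup>2) \<partial>\<gamma>) = ennreal (\<Sum>k. b k * (poly q (y k))\<^sup>2)"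
    and "summable (\<lambda>k. b k * (poly q (y k))\<^sup>2)"
proof -
  let ?q = "q * q"
  have poly: "(poly q t)\<^sup>2 = (\<Sum>i\<le>degree ?q. coeff ?q i * t ^ i)" for t
    unfolding poly_altdef[symmetric] by (simp add: power2_eq_square)
  have eq: "b k * (poly q (y k))\<^sup>2 = (\<Sum>i\<le>degree ?q. coeff ?q i * (b k * y k ^ i))" for k
    unfolding poly by (simp add: sum_distrib_left mult_ac)
  show summable: "summable (\<lambda>k. b k * (poly q (y k))\<^sup>2)"
    unfolding eq by (intro summable_sum summable_mult summ)
  have "has_bochner_integral \<gamma> (\<lambda>t. \<Sum>i\<le>degree ?q. coeff ?q i * t ^ i)
      (\<Sum>i\<le>degree ?q. coeff ?q i * (\<Sum>k. b k * y k ^ i))"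
    using rep by (intro has_bochner_integral_sum has_bochner_integral_mult_right) (simp add: H_representing_def)
  also have "(\<Sum>i\<le>degree ?q. coeff ?q i * (\<Sum>k. b k * y k ^ i)) = (\<Sum>k. b k * (poly q (y k))\<^sup>2)"
    unfolding eq by (subst suminf_sum) (simp_all add: summ summable_mult suminf_mult)
  finally have "has_bochner_integral \<gamma> (\<lambda>t. (poly q t)\<^sup>2) (\<Sum>k. b k * (poly q (y k))\<^sup>2)"
    by (simp only: poly)
  then show "(\<integral>\<^sup>+t. ennreal ((poly q t)\<^sup>2) \<partial>\<gamma>) = ennreal (\<Sum>k. b k * (poly q (y k))\<^sup>2)"
    by (simp add: nn_integral_eq_integral has_bochner_integral_iff)
qed

text \<open>
  The squares of the partial products \<open>P\<^sub>n\<close> of \<open>F(t) = \<Prod>\<^sub>j (1 - t / y\<^sub>j)\<close> have integrals tending to \<open>0\<close>,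
  so by Fatou's lemma a representing measure lives on the zero set of \<open>F\<close>.
  Leaving out the factor with index \<open>l\<close> bounds the mass at \<open>y\<^sub>l\<close> by \<open>b\<^sub>l\<close>; as the total mass
  is \<open>\<Sum>\<^sub>k b\<^sub>k\<close>, all these bounds are attained.
\<close>

proposition H_representing_unique:
  fixes y b :: "nat \<Rightarrow> real"
  assumes y_pos: "\<And>j. 0 < y j" and y_mono: "strict_mono y" and y_summable: "summable (\<lambda>j. 1 / y j)"
    and b_nonneg: "\<And>k. 0 \<le> b k" and b_summable: "\<And>n. summable (\<lambda>k. b k * y k ^ n)"
    and decay: "summable (\<lambda>k. b k * (\<Prod>j<k. y k / y j)\<^sup>2)"
    and rep: "H_representing (\<lambda>n. \<Sum>k. b k * y k ^ n) \<gamma>"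
  shows "\<gamma> = atoms borel y (\<lambda>k. ennreal (b k))"
proof -
  have sets [measurable_cong]: "sets \<gamma> = sets borel"
    using rep by (simp add: H_representing_def)
  have space: "space \<gamma> = UNIV"
    using sets_eq_imp_space_eq[OF sets] by simp
  have total: "emeasure \<gamma> UNIV = ennreal (\<Sum>k. b k)"
    using H_representing_poly_square(1)[OF b_summable rep, of 1] space by simp
  then interpret finite_measure \<gamma>
    by (intro finite_measureI) (simp add: space)
  define P where "P J = (\<Prod>j\<in>J. [:1, - (1 / y j):])" for J :: "nat set"
  have poly_P: "poly (P J) t = (\<Prod>j\<in>J. 1 - t / y j)" for J t
    by (simp add: P_def poly_prod)
  define d where "d k = b k * (\<Prod>j<k. y k / y j)\<^sup>2" for k
  define T where "T n = suminf d - (\<Sum>k\<le>n. d k)" for n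
  have d_nonneg: "0 \<le> d k" for k
    by (simp add: d_def b_nonneg)
  have d_summable: "summable d"
    using decay by (simp add: d_def[abs_def])
  have T_lim: "T \<longlonglongrightarrow> 0"
    using tendsto_diff[OF tendsto_const[of "suminf d"] summable_LIMSEQ'[OF d_summable]]
    by (simp add: T_def[abs_def])
  have integral_le: "(\<integral>\<^sup>+t. ennreal ((poly (P J) t)\<^sup>2) \<partial>\<gamma>) \<le> ennreal ((\<Sum>k\<le>n. b k * (poly (P J) (y k))\<^sup>2) + T n)"
    if J: "J \<subseteq> {..n}" for J n
  proof -
    note summable = H_representing_poly_square(2)[OF b_summable rep, of "P J"]
    \<comment> \<open>For j \<le> n < k the ratio y_k/y_j is at least 1, so |1 - y_k/y_j| is at most
      this ratio, and factors absent from \<open>J\<close> only enlarge the right-hand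
      product.\<close>
    have bound: "b k * (poly (P J) (y k))\<^sup>2 \<le> d k" if "n < k" for k
    proof -
      have ge: "1 \<le> y k / y j" if "j \<le> k" for j
        using y_pos[of j] strict_mono_less_eq[OF y_mono, of j k] that by simp
      have "\<bar>poly (P J) (y k)\<bar> = (\<Prod>j\<in>J. \<bar>1 - y k / y j\<bar>)"
        by (simp add: poly_P abs_prod)
      also have "\<dots> \<le> (\<Prod>j\<in>J. y k / y j)"
      proof (intro prod_mono conjI)
        fix j assume "j \<in> J"
        then show "\<bar>1 - y k / y j\<bar> \<le> y k / y j"
          using ge[of j] J \<open>n < k\<close> by (auto simp: abs_if)
      qed simp
      also have "\<dots> \<le> (\<Prod>j<k. y k / y j)"
        using J \<open>n < k\<close> y_pos ge by (intro prod_mono2) (auto simp: less_imp_le)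
      finally have "(poly (P J) (y k))\<^sup>2 \<le> (\<Prod>j<k. y k / y j)\<^sup>2"
        by (simp add: abs_le_square_iff[symmetric] abs_prod y_pos less_imp_le abs_of_nonneg)
      then show ?thesis
        unfolding d_def by (rule mult_left_mono) (rule b_nonneg)
    qed
    have "(\<Sum>k. b k * (poly (P J) (y k))\<^sup>2) =
        (\<Sum>k. b (k + Suc n) * (poly (P J) (y (k + Suc n)))\<^sup>2) + (\<Sum>k\<le>n. b k * (poly (P J) (y k))\<^sup>2)"
      unfolding lessThan_Suc_atMost[symmetric] by (rule suminf_split_initial_segment[OF summable])
    also have "(\<Sum>k. b (k + Suc n) * (poly (P J) (y (k + Suc n)))\<^sup>2) \<le> (\<Sum>k. d (k + Suc n))"
      using summable_ignore_initial_segment[OF summable, of "Suc n"]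
        summable_ignore_initial_segment[OF d_summable, of "Suc n"]
      by (intro suminf_le bound) auto
    also have "\<dots> = T n"
      unfolding T_def lessThan_Suc_atMost[symmetric] by (rule suminf_minus_initial_segment[OF d_summable])
    finally show ?thesis
      unfolding H_representing_poly_square(1)[OF b_summable rep] by (intro ennreal_leI) simp
  qed
  \<comment> \<open>\<open>I\<close> collects the omitted factors: none for the function F, the
    factor of index l for the mass bound.\<close>
  have conv: "convergent_prod (\<lambda>j. if j \<in> I then 1 else 1 - t / y j)" for t I
  proof (rule abs_convergent_prod_imp_convergent_prod)
    have "summable (\<lambda>j. \<bar>t\<bar> * (1 / y j))"
      by (intro summable_mult y_summable)
    then have "summable (\<lambda>j. norm ((if j \<in> I then 1 else 1 - t / y j) - 1))"
      by (rule summable_comparison_test') (use y_pos in \<open>auto simp: less_imp_le abs_of_pos\<close>)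
    then show "abs_convergent_prod (\<lambda>j. if j \<in> I then 1 else 1 - t / y j)"
      by (simp only: abs_convergent_prod_conv_summable)
  qed

  have AE_range: "AE t in \<gamma>. t \<in> range y"
  proof -
    define F where "F t = (\<Prod>j. 1 - t / y j)" for t
    have lim: "(\<lambda>n. ennreal ((poly (P {..n}) t)\<^sup>2)) \<longlonglongrightarrow> ennreal ((F t)\<^sup>2)" for t
      unfolding poly_P F_def using convergent_prod_LIMSEQ[OF conv[of "{}" t]]
      by (intro tendsto_ennrealI tendsto_power) simp
    have "(\<integral>\<^sup>+t. ennreal ((poly (P {..n}) t)\<^sup>2) \<partial>\<gamma>) \<le> ennreal (T n)" for n
    proof -
      have "(\<Sum>k\<le>n. b k * (poly (P {..n}) (y k))\<^sup>2) = 0"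
        using y_pos by (intro sum.neutral) (auto simp: poly_P prod_zero_iff less_imp_neq[symmetric] intro!: bexI)
      with integral_le[of "{..n}" n] show ?thesis by simp
    qed
    then have "liminf (\<lambda>n. \<integral>\<^sup>+t. ennreal ((poly (P {..n}) t)\<^sup>2) \<partial>\<gamma>) \<le> liminf (\<lambda>n. ennreal (T n))"
      by (intro Liminf_mono always_eventually) simp
    also have "\<dots> = 0"
      using tendsto_ennrealI[OF T_lim] by (intro lim_imp_Liminf) auto
    finally have "liminf (\<lambda>n. \<integral>\<^sup>+t. ennreal ((poly (P {..n}) t)\<^sup>2) \<partial>\<gamma>) = 0"
      by simp
    moreover have "(\<integral>\<^sup>+t. liminf (\<lambda>n. ennreal ((poly (P {..n}) t)\<^sup>2)) \<partial>\<gamma>) \<le>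
        liminf (\<lambda>n. \<integral>\<^sup>+t. ennreal ((poly (P {..n}) t)\<^sup>2) \<partial>\<gamma>)"
      unfolding poly_P by (intro nn_integral_liminf) simp
    ultimately have "(\<integral>\<^sup>+t. liminf (\<lambda>n. ennreal ((poly (P {..n}) t)\<^sup>2)) \<partial>\<gamma>) = 0"
      by simp
    then have "AE t in \<gamma>. liminf (\<lambda>n. ennreal ((poly (P {..n}) t)\<^sup>2)) = 0"
      unfolding poly_P by (subst (asm) nn_integral_0_iff_AE) auto
    then show ?thesis
    proof (rule AE_mp, intro AE_I2 impI)
      fix t assume "liminf (\<lambda>n. ennreal ((poly (P {..n}) t)\<^sup>2)) = 0"
      moreover have "liminf (\<lambda>n. ennreal ((poly (P {..n}) t)\<^sup>2)) = ennreal ((F t)\<^sup>2)"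
        by (rule lim_imp_Liminf[OF _ lim]) simp
      ultimately have "F t = 0"
        by simp
      \<comment> \<open>A convergent infinite product vanishes only if one of its factors
        does.\<close>
      then obtain j where "1 - t / y j = 0"
        using prodinf_nonzero[OF conv[of "{}" t]] by (auto simp: F_def)
      then show "t \<in> range y"
        using y_pos[of j] by (auto simp: field_simps)
    qed
  qed

  have mass_le: "measure \<gamma> {y l} \<le> b l" for l
  proof -
    define q where "q n = (poly (P ({..n} - {l})) (y l))\<^sup>2" for n
    define c where "c j = (if j \<in> {l} then 1 else 1 - y l / y j)" for j
    have "measure \<gamma> {y l} * q n \<le> b l * q n + T n" if "l \<le> n" for n
    proof -
      let ?Q = "P ({..n} - {l})"
      have "poly ?Q (y k) = 0" if "k \<le> n" "k \<noteq> l" for k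
        using that y_pos[of k] by (auto simp: poly_P prod_zero_iff intro!: bexI[of _ k])
      then have "(\<Sum>k\<le>n. b k * (poly ?Q (y k))\<^sup>2) = (\<Sum>k\<in>{l}. b k * (poly ?Q (y k))\<^sup>2)"
        using \<open>l \<le> n\<close> by (intro sum.mono_neutral_right) auto
      then have *: "(\<integral>\<^sup>+t. ennreal ((poly ?Q t)\<^sup>2) \<partial>\<gamma>) \<le> ennreal (b l * q n + T n)"
        using integral_le[of "{..n} - {l}" n] by (simp add: q_def)
      have "ennreal (measure \<gamma> {y l} * q n) = (\<integral>\<^sup>+t. ennreal (q n) * indicator {y l} t \<partial>\<gamma>)"
        by (subst nn_integral_cmult_indicator) (auto simp: sets emeasure_eq_measure ennreal_mult q_def mult.commute)
      also have "\<dots> \<le> (\<integral>\<^sup>+t. ennreal ((poly ?Q t)\<^sup>2) \<partial>\<gamma>)"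
        by (intro nn_integral_mono) (auto simp: q_def indicator_def)
      also note *
      finally have le: "ennreal (measure \<gamma> {y l} * q n) \<le> ennreal (b l * q n + T n)" .
      have "0 \<le> T n"
        unfolding T_def using d_nonneg by (simp add: sum_le_suminf d_summable)
      then show ?thesis
        using le b_nonneg[of l] by (subst (asm) ennreal_le_iff) (auto simp: q_def)
    qed
    then have ev: "\<forall>\<^sub>F n in sequentially. measure \<gamma> {y l} * q n \<le> b l * q n + T n"
      by (auto intro: eventually_mono[OF eventually_ge_at_top[of l]])
    have "(\<Prod>j\<le>n. c j) = (\<Prod>j\<in>{..n} - {l}. 1 - y l / y j)" for n
      by (intro prod.mono_neutral_cong_right) (auto simp: c_def)
    then have q_eq: "q n = (\<Prod>j\<le>n. c j)\<^sup>2" for n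
      by (simp add: q_def poly_P)
    have c: "convergent_prod c"
      unfolding c_def by (rule conv)
    have q_lim: "q \<longlonglongrightarrow> (prodinf c)\<^sup>2"
      unfolding q_eq[abs_def] by (intro tendsto_power convergent_prod_LIMSEQ c)
    \<comment> \<open>The points are distinct and the factor at l is replaced by 1, so the limit of
      \<open>q\<close> is nonzero and cancels from the limiting inequality.\<close>
    have "c j \<noteq> 0" for j
      using y_pos[of j] y_mono by (auto simp: c_def field_simps strict_mono_eq)
    then have "prodinf c \<noteq> 0"
      by (intro prodinf_nonzero c)
    have "measure \<gamma> {y l} * (prodinf c)\<^sup>2 \<le> b l * (prodinf c)\<^sup>2 + 0"
      by (rule tendsto_le[OF sequentially_bot _ _ ev]) (intro tendsto_intros q_lim T_lim)+
    then show ?thesis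
      using \<open>prodinf c \<noteq> 0\<close> by simp
  qed

  have decompose: "emeasure \<gamma> A = (\<Sum>k. ennreal (measure \<gamma> {y k}) * indicator A (y k))"
    if [measurable]: "A \<in> sets borel" for A
  proof -
    have inj: "y i = y j \<longleftrightarrow> i = j" for i j
      by (rule strict_mono_eq[OF y_mono])
    have "emeasure \<gamma> A = emeasure \<gamma> (\<Union>k. A \<inter> {y k})"
      using AE_range by (intro emeasure_eq_AE) (auto simp: sets intro!: sets.countable_UN)
    also have "\<dots> = (\<Sum>k. emeasure \<gamma> (A \<inter> {y k}))"
      by (intro suminf_emeasure[symmetric]) (auto simp: sets disjoint_family_on_def inj)
    also have "\<dots> = (\<Sum>k. ennreal (measure \<gamma> {y k}) * indicator A (y k))"
      by (intro arg_cong[where f = suminf] ext) (auto simp: indicator_def emeasure_eq_measure)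
    finally show ?thesis .
  qed
  have b_sum: "summable b"
    using b_summable[of 0] by simp
  have m_sum: "summable (\<lambda>k. measure \<gamma> {y k})"
    using b_sum by (rule summable_comparison_test') (simp add: mass_le)
  have "(\<Sum>k. measure \<gamma> {y k}) = (\<Sum>k. b k)"
  proof -
    have "ennreal (\<Sum>k. measure \<gamma> {y k}) = ennreal (\<Sum>k. b k)"
      using decompose[of UNIV] total by (simp add: suminf_ennreal2 m_sum)
    then show ?thesis
      by (subst (asm) ennreal_inj) (auto intro!: suminf_nonneg m_sum b_sum b_nonneg)
  qed
  then have "(\<Sum>k. b k - measure \<gamma> {y k}) = 0"
    by (simp add: suminf_diff[symmetric] m_sum b_sum)
  then have "b k - measure \<gamma> {y k} = 0" for k
    using suminf_eq_zero_iff[of "\<lambda>k. b k - measure \<gamma> {y k}"] mass_le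
    by (auto simp: summable_diff m_sum b_sum)
  then have mass_eq: "measure \<gamma> {y k} = b k" for k
    by (metis eq_iff_diff_eq_0)
  show ?thesis
  proof (rule measure_eqI)
    fix A assume "A \<in> sets \<gamma>"
    then have "A \<in> sets borel" by (simp add: sets)
    then show "emeasure \<gamma> A = emeasure (atoms borel y (\<lambda>k. ennreal (b k))) A"
      by (simp add: decompose emeasure_atoms mass_eq)
  qed (simp add: sets)
qed

subsection \<open>A signed measure with vanishing moments\<close>

text \<open>
  With \<open>q = 1/4\<close> the coefficients are \<open>q\<^bsup>m(m-1)/2\<^esup> / ((1 - q) \<dots> (1 - q\<^sup>m))\<close>, so that
  \<open>\<Sum>\<^sub>m (-1)\<^sup>m qcoeff m z\<^sup>m\<close> is Euler's expansion of \<open>\<Prod>\<^sub>j (1 - q\<^sup>j z)\<close>, which vanishes at \<open>z = 4\<^sup>n\<close>.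
  Hence the signed measure \<open>\<Sum>\<^sub>m (-1)\<^sup>m qcoeff m \<delta>\<^bsub>4^m\<^esub>\<close> has zero moments, and its even and odd parts
  are measures with equal moments.
\<close>

primrec qcoeff :: "nat \<Rightarrow> real" where
  "qcoeff 0 = 1"
| "qcoeff (Suc m) = qcoeff m * ((1 / 4) ^ m / (1 - (1 / 4) ^ Suc m))"

lemma quarter_power_le: "(1 / 4 :: real) ^ Suc m \<le> 1 / 4"
  by (simp add: power_le_one)

lemma qfactor: "0 < (1 / 4 :: real) ^ m / (1 - (1 / 4) ^ Suc m)"
  "(1 / 4 :: real) ^ m / (1 - (1 / 4) ^ Suc m) \<le> 4 / 3 * (1 / 4) ^ m"
proof -
  have *: "3 / 4 \<le> 1 - (1 / 4 :: real) ^ Suc m"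
    using quarter_power_le[of m] by linarith
  then show "0 < (1 / 4 :: real) ^ m / (1 - (1 / 4) ^ Suc m)"
    by (intro divide_pos_pos) auto
  have "(1 / 4 :: real) ^ m / (1 - (1 / 4) ^ Suc m) \<le> (1 / 4) ^ m / (3 / 4)"
    using * by (intro divide_left_mono mult_pos_pos) auto
  then show "(1 / 4 :: real) ^ m / (1 - (1 / 4) ^ Suc m) \<le> 4 / 3 * (1 / 4) ^ m"
    by simp
qed

lemma qcoeff_pos: "0 < qcoeff m"
proof (induction m)
  case (Suc m)
  then show ?case
    unfolding qcoeff.simps by (intro mult_pos_pos qfactor(1))
qed simp

lemma qcoeff_Suc_le: "qcoeff (Suc m) \<le> qcoeff m * (4 / 3 * (1 / 4) ^ m)"
  unfolding qcoeff.simps by (intro mult_left_mono qfactor(2) less_imp_le[OF qcoeff_pos])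

lemma summable_qcoeff:
  assumes "0 \<le> z"
  shows "summable (\<lambda>m. qcoeff m * z ^ m)"
proof -
  have "(\<lambda>m. (4 / 3 * (1 / 4) ^ m) * z) \<longlonglongrightarrow> 4 / 3 * 0 * z"
    by (intro tendsto_intros LIMSEQ_power_zero) simp
  then have "\<forall>\<^sub>F m in sequentially. (4 / 3 * (1 / 4) ^ m) * z < 1 / 2"
    by (rule order_tendstoD) simp
  then obtain N where N: "(4 / 3 * (1 / 4) ^ m) * z < 1 / 2" if "N \<le> m" for m
    by (auto simp: eventually_sequentially)
  show ?thesis
  proof (rule summable_ratio_test)
    show "(1 / 2 :: real) < 1" by simp
    fix m assume m: "N \<le> m"
    have "qcoeff (Suc m) * z ^ Suc m \<le> qcoeff m * (4 / 3 * (1 / 4) ^ m) * z ^ Suc m"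
      using assms qcoeff_Suc_le by (intro mult_right_mono) auto
    also have "\<dots> = ((4 / 3 * (1 / 4) ^ m) * z) * (qcoeff m * z ^ m)"
      by simp
    also have "\<dots> \<le> 1 / 2 * (qcoeff m * z ^ m)"
      using N[OF m] assms qcoeff_pos[of m] by (intro mult_right_mono) auto
    finally show "norm (qcoeff (Suc m) * z ^ Suc m) \<le> 1 / 2 * norm (qcoeff m * z ^ m)"
      using assms qcoeff_pos[of m] qcoeff_pos[of "Suc m"] by (simp add: abs_mult del: qcoeff.simps)
  qed
qed

definition qseries :: "real \<Rightarrow> real" where
  "qseries z = (\<Sum>m. (-1) ^ m * (qcoeff m * z ^ m))"

lemma summable_qseries:
  assumes "0 \<le> z"
  shows "summable (\<lambda>m. (-1) ^ m * (qcoeff m * z ^ m))"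
  by (rule summable_comparison_test'[OF summable_qcoeff[OF assms]])
     (use assms in \<open>simp add: abs_mult less_imp_le[OF qcoeff_pos]\<close>)

text \<open>The recursion for \<open>qcoeff\<close>, read as an identity of power series. It carries
  the information of Euler's product: splitting off the factor 1 - z rescales the rest.\<close>

lemma qseries_functional_equation:
  assumes "0 \<le> z"
  shows "qseries z = (1 - z) * qseries (z / 4)"
proof -
  let ?f = "\<lambda>z m. (-1) ^ m * (qcoeff m * z ^ m)"
  have s: "summable (?f z)" "summable (?f (z / 4))"
    using assms by (simp_all add: summable_qseries)
  have "qseries z - qseries (z / 4) = (\<Sum>m. ?f z m - ?f (z / 4) m)"
    unfolding qseries_def by (rule suminf_diff[OF s])
  also have "\<dots> = (\<Sum>m. ?f z (Suc m) - ?f (z / 4) (Suc m))"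
    using suminf_split_head[OF summable_diff[OF s]] by simp
  also have "\<dots> = (\<Sum>m. - z * ?f (z / 4) m)"
  proof (intro arg_cong[where f = suminf] ext)
    fix m
    have "1 - (1 / 4 :: real) ^ Suc m \<noteq> 0"
      using quarter_power_le[of m] by linarith
    then have q: "qcoeff (Suc m) * (1 - (1 / 4) ^ Suc m) = qcoeff m * (1 / 4) ^ m"
      by (simp del: power_Suc)
    have "?f z (Suc m) - ?f (z / 4) (Suc m) = (-1) ^ Suc m * z ^ Suc m * (qcoeff (Suc m) * (1 - (1 / 4) ^ Suc m))"
      by (simp only: power_divide) (simp add: power_divide field_simps del: qcoeff.simps power_Suc)
    also have "\<dots> = - z * ?f (z / 4) m"
      unfolding q by (simp add: power_divide)
    finally show "?f z (Suc m) - ?f (z / 4) (Suc m) = - z * ?f (z / 4) m" .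
  qed
  also have "\<dots> = - z * qseries (z / 4)"
    unfolding qseries_def by (rule suminf_mult[OF s(2)])
  finally show ?thesis
    by (simp add: algebra_simps)
qed

text \<open>The factor 1 - z gives the zero at 1, and the functional equation carries it from z to
  4z.\<close>

lemma qseries_eq_0: "qseries (4 ^ n) = 0"
  by (induction n) (simp_all add: qseries_functional_equation[of 1] qseries_functional_equation[of "4 * 4 ^ _"])

text \<open>The value at 1/4 is the integral of 1/x over the signed measure. The series alternates
  with decreasing terms, so it is at least its first two terms, 1 - 1/3.\<close>

lemma qseries_quarter_pos: "0 < qseries (1 / 4)"
proof -
  define c where "c m = qcoeff m * (1 / 4) ^ m" for m
  have c: "0 \<le> c m" "c (Suc m) \<le> c m" for m
  proof -
    show "0 \<le> c m"
      using qcoeff_pos[of m] by (simp add: c_def)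
    have "qcoeff (Suc m) * (1 / 4) ^ Suc m \<le> (qcoeff m * (4 / 3 * (1 / 4) ^ m)) * (1 / 4)"
      using qcoeff_Suc_le[of m] quarter_power_le[of m] qcoeff_pos[of "Suc m"] qcoeff_pos[of m]
      by (intro mult_mono) auto
    also have "\<dots> \<le> qcoeff m * (1 / 4) ^ m"
      using qcoeff_pos[of m] by simp
    finally show "c (Suc m) \<le> c m"
      by (simp only: c_def)
  qed
  have "summable c"
    unfolding c_def using summable_qcoeff[of "1 / 4"] by simp
  then have "(\<Sum>i<2 * 1. (-1) ^ i * c i) \<le> (\<Sum>i. (-1) ^ i * c i)"
    using c by (intro summable_Leibniz'(2) summable_LIMSEQ_zero) auto
  then show ?thesis
    by (simp add: qseries_def c_def numeral_2_eq_2)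
qed

section \<open>Splitting the signed measure by sign\<close>

lemma sums_parity:
  fixes a :: "nat \<Rightarrow> real"
  assumes "(\<lambda>i. a (2 * i)) sums s" "(\<lambda>i. a (Suc (2 * i))) sums t"
  shows "a sums (s + t)"
proof -
  have "(\<lambda>n. if even n then a (2 * (n div 2)) else a (Suc (2 * ((n - 1) div 2)))) = a"
    by (auto elim!: oddE)
  with sums_if[OF assms(2,1)] show ?thesis
    by (simp add: add.commute)
qed

text \<open>At z = 4^n this is the nth moment of the positive part of the signed measure, at z = 1/4
  its integral of 1/x.\<close>

definition even_part :: "real \<Rightarrow> real" where
  "even_part z = (\<Sum>i. qcoeff (2 * i) * z ^ (2 * i))"

definition odd_part :: "real \<Rightarrow> real" where
  "odd_part z = (\<Sum>i. qcoeff (Suc (2 * i)) * z ^ Suc (2 * i))"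

lemma even_part_sums: "0 \<le> z \<Longrightarrow> (\<lambda>i. qcoeff (2 * i) * z ^ (2 * i)) sums even_part z"
  unfolding even_part_def
  using summable_reindex[OF summable_qcoeff, of z "\<lambda>i. 2 * i"] qcoeff_pos
  by (intro summable_sums) (simp add: inj_on_def o_def less_imp_le)

lemma odd_part_sums: "0 \<le> z \<Longrightarrow> (\<lambda>i. qcoeff (Suc (2 * i)) * z ^ Suc (2 * i)) sums odd_part z"
  unfolding odd_part_def
  using summable_reindex[OF summable_qcoeff, of z "\<lambda>i. Suc (2 * i)"] qcoeff_pos
  by (intro summable_sums) (simp add: inj_on_def o_def less_imp_le del: qcoeff.simps power_Suc)

lemma qseries_parity:
  assumes "0 \<le> z"
  shows "qseries z = even_part z - odd_part z"
proof -
  have "(\<lambda>m. (-1) ^ m * (qcoeff m * z ^ m)) sums (even_part z + - odd_part z)"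
    using even_part_sums[OF assms] sums_minus[OF odd_part_sums[OF assms]]
    by (intro sums_parity) (simp_all del: qcoeff.simps)
  then show ?thesis
    by (simp add: qseries_def sums_iff)
qed

lemma even_part_eq_odd_part: "even_part (4 ^ n) = odd_part (4 ^ n)"
  using qseries_parity[of "4 ^ n"] by (simp add: qseries_eq_0)

lemma odd_part_less_even_part: "odd_part (1 / 4) < even_part (1 / 4)"
  using qseries_parity[of "1 / 4"] qseries_quarter_pos by simp

lemma odd_part_pos: "0 < z \<Longrightarrow> 0 < odd_part z"
  unfolding odd_part_def
  by (intro suminf_pos sums_summable[OF odd_part_sums] mult_pos_pos qcoeff_pos zero_less_power) simp_all

lemma power_4_swap: "((4::real) ^ m) ^ n = (4 ^ n) ^ m"
  by (simp add: mult.commute flip: power_mult)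

text \<open>
  The trunk measure is a multiple of the odd part plus \<open>d\<close> times the even part.
  For \<open>d = 0\<close> the moments of \<open>e\<^sub>0\<close> are H-determinate, for \<open>d = 1\<close> they are S-indeterminate.
\<close>

context
  fixes d :: real
  assumes d_nonneg: "0 \<le> d"
begin

definition scale :: real where
  "scale = 1 / (odd_part (1 / 4) + d * even_part (1 / 4))"

definition trunk_mass :: "nat \<Rightarrow> real" where
  "trunk_mass m = scale * ((if even m then d else 1) * qcoeff m)"

text \<open>The factor 1 + d balances the moments: the trunk carries one odd and d even parts, all
  with the same moments.\<close>

definition branch_mass :: "nat \<Rightarrow> real" where
  "branch_mass i = scale * ((1 + d) * qcoeff (2 * i))"

lemma scale_pos: "0 < scale"
  unfolding scale_def using odd_part_pos[of "1 / 4"] odd_part_less_even_part d_nonneg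
  by (intro divide_pos_pos add_pos_nonneg mult_nonneg_nonneg) auto

lemma trunk_mass_nonneg: "0 \<le> trunk_mass m"
  unfolding trunk_mass_def using scale_pos d_nonneg qcoeff_pos[of m]
  by (intro mult_nonneg_nonneg) auto

lemma trunk_mass_sums:
  assumes "0 \<le> z"
  shows "(\<lambda>m. trunk_mass m * z ^ m) sums (scale * (odd_part z + d * even_part z))"
proof -
  have "(\<lambda>m. trunk_mass m * z ^ m) sums (scale * (d * even_part z) + scale * odd_part z)"
  proof (rule sums_parity)
    show "(\<lambda>i. trunk_mass (2 * i) * z ^ (2 * i)) sums (scale * (d * even_part z))"
      using sums_mult[OF even_part_sums[OF assms], of "scale * d"] by (simp add: trunk_mass_def mult.assoc)
    show "(\<lambda>i. trunk_mass (Suc (2 * i)) * z ^ Suc (2 * i)) sums (scale * odd_part z)"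
      using sums_mult[OF odd_part_sums[OF assms], of scale]
      by (simp add: trunk_mass_def mult.assoc del: qcoeff.simps power_Suc)
  qed
  then show ?thesis
    by (simp add: algebra_simps)
qed

lemma branch_mass_sums:
  assumes "0 \<le> z"
  shows "(\<lambda>i. branch_mass i * z ^ (2 * i)) sums (scale * ((1 + d) * even_part z))"
  using sums_mult[OF even_part_sums[OF assms], of "scale * (1 + d)"] by (simp add: branch_mass_def mult.assoc)

lemma branching_data: "branching_data (\<lambda>m. 4 ^ m) trunk_mass branch_mass (\<lambda>i. 2 * i)"
proof
  show "1 \<le> (4::real) ^ m" for m
    by simp
  show "0 \<le> trunk_mass m" for m
    by (rule trunk_mass_nonneg)
  show "0 < branch_mass i" for i
    unfolding branch_mass_def using scale_pos d_nonneg qcoeff_pos by (intro mult_pos_pos) auto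
  show "summable (\<lambda>m. trunk_mass m * (4 ^ m) ^ n)" for n
    unfolding power_4_swap[of _ n] using trunk_mass_sums[of "4 ^ n"] by (simp add: sums_iff)
  have moments: "(\<Sum>m. trunk_mass m * (4 ^ m) ^ n) = scale * ((1 + d) * even_part (4 ^ n))" for n
    unfolding power_4_swap[of _ n] using trunk_mass_sums[of "4 ^ n"]
    by (simp add: sums_iff even_part_eq_odd_part algebra_simps)
  show "(\<lambda>i. branch_mass i * (4 ^ (2 * i)) ^ n) sums (\<Sum>m. trunk_mass m * (4 ^ m) ^ n)" for n
    unfolding moments unfolding power_4_swap[of _ n] by (rule branch_mass_sums) simp
  have inv: "a / 4 ^ m = a * (1 / 4) ^ m" for a :: real and m
    by (simp add: power_divide)
  have nz: "odd_part (1 / 4) + d * even_part (1 / 4) \<noteq> 0"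
    using scale_pos by (auto simp: scale_def)
  show "(\<Sum>m. trunk_mass m / 4 ^ m) = 1"
    unfolding inv using trunk_mass_sums[of "1 / 4"] nz by (simp add: sums_iff scale_def)
  have "(\<Sum>i. branch_mass i / 4 ^ (2 * i)) = scale * ((1 + d) * even_part (1 / 4))"
    unfolding inv using branch_mass_sums[of "1 / 4"] by (simp add: sums_iff)
  \<comment> \<open>The excess is \<open>scale\<close> times the even minus the odd inverse moment;
    this difference does not involve d, so every d \<ge> 0 is admissible.\<close>
  moreover have "scale * (odd_part (1 / 4) + d * even_part (1 / 4)) < scale * ((1 + d) * even_part (1 / 4))"
    using scale_pos odd_part_less_even_part by (simp add: algebra_simps)
  moreover have "scale * (odd_part (1 / 4) + d * even_part (1 / 4)) = 1"
    using nz by (simp add: scale_def)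
  ultimately show "1 < (\<Sum>i. branch_mass i / 4 ^ (2 * i))"
    by simp
qed

end

lemma H_determinate_odd:
  "H_determinate (\<lambda>n. \<Sum>m. trunk_mass 0 m / 4 ^ m * (4 ^ m) ^ n)"
proof -
  define y where "y k = (4::real) ^ Suc (2 * k)" for k
  define b where "b k = trunk_mass 0 (Suc (2 * k)) / y k" for k
  have r_nonneg: "0 \<le> trunk_mass 0 m" for m
    by (rule trunk_mass_nonneg) simp
  have y_pos: "0 < y j" for j
    by (simp add: y_def)
  have b_pos: "0 < b k" for k
    using scale_pos[of 0] qcoeff_pos[of "Suc (2 * k)"] y_pos[of k]
    by (simp add: b_def trunk_mass_def del: qcoeff.simps)
  have sums: "(\<lambda>k. b k * y k ^ n) sums (\<Sum>m. trunk_mass 0 m / 4 ^ m * (4 ^ m) ^ n)" for n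
  proof -
    let ?a = "\<lambda>m. trunk_mass 0 m / 4 ^ m * (4 ^ m) ^ n"
    have "summable ?a"
    proof (rule summable_comparison_test')
      show "summable (\<lambda>m. trunk_mass 0 m * (4 ^ m) ^ n)"
        unfolding power_4_swap[of _ n] using trunk_mass_sums[of 0 "4 ^ n"] by (simp add: sums_iff)
      fix m
      have "trunk_mass 0 m / 4 ^ m \<le> trunk_mass 0 m / 1"
        using r_nonneg[of m] by (intro divide_left_mono) auto
      then have "trunk_mass 0 m / 4 ^ m * (4 ^ m) ^ n \<le> trunk_mass 0 m / 1 * (4 ^ m) ^ n"
        by (rule mult_right_mono) simp
      then show "norm (?a m) \<le> trunk_mass 0 m * (4 ^ m) ^ n"
        using r_nonneg[of m] by simp
    qed
    moreover from this have "summable (\<lambda>k. b k * y k ^ n)"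
      using summable_reindex[of ?a "\<lambda>k. Suc (2 * k)"] r_nonneg
      by (simp add: inj_on_def o_def b_def y_def del: power_Suc)
    \<comment> \<open>For d = 0 the even atoms have no mass and contribute the summand 0.\<close>
    then have "?a sums (0 + (\<Sum>k. b k * y k ^ n))"
      by (intro sums_parity) (simp_all add: trunk_mass_def sums_iff b_def y_def del: power_Suc qcoeff.simps)
    ultimately show ?thesis
      using \<open>summable (\<lambda>k. b k * y k ^ n)\<close> by (simp add: sums_iff)
  qed
  then have seq: "(\<lambda>n. \<Sum>m. trunk_mass 0 m / 4 ^ m * (4 ^ m) ^ n) = (\<lambda>n. \<Sum>k. b k * y k ^ n)"
    by (simp add: sums_iff)
  have b_summable: "summable (\<lambda>k. b k * y k ^ n)" for n
    using sums by (rule sums_summable)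
  have "summable (\<lambda>j. 1 / y j)"
  proof (rule summable_comparison_test')
    show "summable (\<lambda>j. (1 / 2 :: real) ^ j)"
      by (simp add: summable_geometric)
    fix j
    have "(2::real) ^ j \<le> 4 ^ Suc (2 * j)"
      by (rule order_trans[OF power_mono[of 2 4 j] power_increasing]) auto
    then show "norm (1 / y j) \<le> (1 / 2) ^ j"
      by (simp add: y_def power_one_over field_simps)
  qed
  moreover have "summable (\<lambda>k. b k * (\<Prod>j<k. y k / y j)\<^sup>2)"
  proof (rule summable_ratio_test)
    \<comment> \<open>The squared product grows by 4^(4k+4) and \<open>b\<close> shrinks by at least
      the factor (16/9) (1/16) 4^-(4k+3), so the powers cancel and 4/9 remains. The 1/16 comes from
      dividing \<rho> by x; for \<rho> itself the same estimate would give only 64/9.\<close>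
    show "(4 / 9 :: real) < 1" by simp
    fix k :: nat
    have y_Suc: "y (Suc k) = 16 * y k" for k
      by (simp add: y_def)
    have y_0: "y k / y 0 = 16 ^ k" for k
      by (induction k) (auto simp: y_Suc y_def)
    have prod: "(\<Prod>j<Suc k. y (Suc k) / y j) = 16 ^ Suc k * (\<Prod>j<k. y k / y j)"
      unfolding prod.lessThan_Suc_shift using y_0[of "Suc k"] by (simp add: y_Suc)
    have "b (Suc k) \<le> b k * (16 / 9 * (1 / 16) * (1 / 4) ^ (4 * k + 3))"
    proof -
      have "qcoeff (Suc (2 * Suc k)) \<le> qcoeff (2 * Suc k) * (4 / 3 * (1 / 4) ^ (2 * Suc k))"
        by (rule qcoeff_Suc_le)
      also have "2 * Suc k = Suc (Suc (2 * k))"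
        by simp
      also have "qcoeff (Suc (Suc (2 * k))) * (4 / 3 * (1 / 4) ^ Suc (Suc (2 * k))) \<le>
          qcoeff (Suc (2 * k)) * (4 / 3 * (1 / 4) ^ Suc (2 * k)) * (4 / 3 * (1 / 4) ^ Suc (Suc (2 * k)))"
        by (intro mult_right_mono qcoeff_Suc_le) simp
      also have "\<dots> = qcoeff (Suc (2 * k)) * (16 / 9 * (1 / 4) ^ (4 * k + 3))"
        by (simp add: power_add power_mult power_divide field_simps del: qcoeff.simps)
      finally have "qcoeff (Suc (2 * Suc k)) \<le> qcoeff (Suc (2 * k)) * (16 / 9 * (1 / 4) ^ (4 * k + 3))"
        by simp
      then have "scale 0 * qcoeff (Suc (2 * Suc k)) / y (Suc k) \<le>
          scale 0 * (qcoeff (Suc (2 * k)) * (16 / 9 * (1 / 4) ^ (4 * k + 3))) / y (Suc k)"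
        using scale_pos[of 0] y_pos[of "Suc k"] by (intro divide_right_mono mult_left_mono) auto
      then show ?thesis
        by (simp add: b_def trunk_mass_def y_Suc field_simps del: qcoeff.simps)
    qed
    then have "b (Suc k) * (16 ^ Suc k * (\<Prod>j<k. y k / y j))\<^sup>2 \<le>
        b k * (16 / 9 * (1 / 16) * (1 / 4) ^ (4 * k + 3)) * (16 ^ Suc k * (\<Prod>j<k. y k / y j))\<^sup>2"
      by (rule mult_right_mono) simp
    also have "\<dots> = (16 / 9 * (1 / 16) * (1 / 4) ^ (4 * k + 3) * (16 ^ Suc k)\<^sup>2) * (b k * (\<Prod>j<k. y k / y j)\<^sup>2)"
      by (simp add: power_mult_distrib)
    also have "16 / 9 * (1 / 16) * (1 / 4) ^ (4 * k + 3) * (16 ^ Suc k)\<^sup>2 = (4 / 9 :: real)"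
    proof -
      have "(16 ^ Suc k)\<^sup>2 = (4 :: real) ^ (4 * k + 4)"
        by (induction k) (simp_all add: power2_eq_square power_add)
      then show ?thesis
        by (simp add: power_add power_divide)
    qed
    finally show "norm (b (Suc k) * (\<Prod>j<Suc k. y (Suc k) / y j)\<^sup>2) \<le> 4 / 9 * norm (b k * (\<Prod>j<k. y k / y j)\<^sup>2)"
      using b_pos[of k] b_pos[of "Suc k"] unfolding prod by (simp add: abs_mult)
  qed
  moreover have "strict_mono y"
    by (intro strict_monoI) (simp add: y_def)
  ultimately have "\<gamma> = atoms borel y (\<lambda>k. ennreal (b k))"
    if "H_representing (\<lambda>n. \<Sum>k. b k * y k ^ n) \<gamma>" for \<gamma>
    using that y_pos b_pos b_summable by (intro H_representing_unique) (auto intro: less_imp_le)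
  moreover have "H_representing (\<lambda>n. \<Sum>k. b k * y k ^ n) (atoms borel y (\<lambda>k. ennreal (b k)))"
    unfolding H_representing_def
  proof (intro conjI allI atoms_moment)
    fix n
    have nonneg: "0 \<le> b k * y k ^ n" for k
      using b_pos[of k] y_pos[of k] by simp
    show "0 \<le> (\<Sum>k. b k * y k ^ n)"
      by (intro suminf_nonneg b_summable nonneg)
    have "(\<Sum>k. ennreal (b k * y k ^ n)) = ennreal (\<Sum>k. b k * y k ^ n)"
      by (intro suminf_ennreal2 b_summable nonneg)
    then show "(\<Sum>k. ennreal (b k) * ennreal (y k ^ n)) = ennreal (\<Sum>k. b k * y k ^ n)"
      using b_pos y_pos by (simp add: ennreal_mult less_imp_le)
  qed (use y_pos in \<open>auto intro: less_imp_le\<close>)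
  ultimately show ?thesis
    unfolding H_determinate_def seq by blast
qed

text \<open>Twice the odd part has the moments of odd plus even. Dividing both by x alters only the
  agreement of the zeroth moments, where the odd version falls short by \<open>e\<close>. An atom of
  mass \<open>e\<close> at 0 fills the gap without affecting higher moments, and the mixture has no
  atom there.\<close>

lemma S_indeterminate_mixture:
  "S_indeterminate (\<lambda>n. \<Sum>m. trunk_mass 1 m / 4 ^ m * (4 ^ m) ^ n)"
proof -
  have r_nonneg: "0 \<le> trunk_mass 1 m" for m
    by (rule trunk_mass_nonneg) simp
  define \<gamma> where "\<gamma> n = (\<Sum>m. trunk_mass 1 m / 4 ^ m * (4 ^ m) ^ n)" for n :: nat
  define c where "c = scale 1"
  have c: "0 < c" "c * (odd_part (1 / 4) + even_part (1 / 4)) = 1"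
    using scale_pos[of 1] unfolding c_def by (auto simp: scale_def)
  define e where "e = 1 - 2 * c * odd_part (1 / 4)"
  have "c * odd_part (1 / 4) < c * even_part (1 / 4)"
    using c(1) odd_part_less_even_part by simp
  with c(2) have e_pos: "0 < e"
    by (simp add: e_def algebra_simps)
  have \<gamma>_sums: "(\<lambda>m. trunk_mass 1 m / 4 ^ m * (4 ^ m) ^ n) sums \<gamma> n"
    and \<gamma>_0: "\<gamma> 0 = 1" and \<gamma>_Suc: "\<gamma> (Suc l) = 2 * c * odd_part (4 ^ l)" for n l
  proof -
    have "(\<lambda>m. trunk_mass 1 m * (1 / 4) ^ m) sums 1"
      using trunk_mass_sums[of 1 "1 / 4"] c(2) by (simp add: c_def)
    then have 0: "(\<lambda>m. trunk_mass 1 m / 4 ^ m * (4 ^ m) ^ 0) sums 1"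
      by (simp add: power_divide)
    have Suc: "(\<lambda>m. trunk_mass 1 m / 4 ^ m * (4 ^ m) ^ Suc l) sums (2 * c * odd_part (4 ^ l))" for l
      using trunk_mass_sums[of 1 "4 ^ l"] by (simp add: power_4_swap[of _ l] even_part_eq_odd_part c_def mult_ac)
    show "(\<lambda>m. trunk_mass 1 m / 4 ^ m * (4 ^ m) ^ n) sums \<gamma> n"
      using 0 Suc by (cases n) (auto simp: \<gamma>_def sums_iff)
    show "\<gamma> 0 = 1" "\<gamma> (Suc l) = 2 * c * odd_part (4 ^ l)"
      using 0 Suc unfolding \<gamma>_def sums_iff by blast+
  qed
  define R where "R = restrict_space borel {0::real..}"
  define \<mu> where "\<mu> = atoms R (\<lambda>m. 4 ^ m) (\<lambda>m. ennreal (trunk_mass 1 m / 4 ^ m))"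
  \<comment> \<open>Index 0 holds the extra atom at 0; index k + 1 holds the kth odd power of
    4.\<close>
  define y where "y = case_nat 0 (\<lambda>k. (4::real) ^ Suc (2 * k))"
  define a where "a = case_nat e (\<lambda>k. 2 * c * qcoeff (Suc (2 * k)) / 4 ^ Suc (2 * k))"
  define \<nu> where "\<nu> = atoms R y (\<lambda>k. ennreal (a k))"
  have y_nonneg: "0 \<le> y k" for k
    by (simp add: y_def split: nat.split)
  have a_nonneg: "0 \<le> a k" for k
    using e_pos c(1) qcoeff_pos by (simp add: a_def less_imp_le split: nat.split del: qcoeff.simps)
  have \<gamma>_nonneg: "0 \<le> \<gamma> n" for n
    using sums_le[OF _ sums_zero \<gamma>_sums] r_nonneg by simp
  have "S_representing \<gamma> \<mu>"
    unfolding \<mu>_def R_def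
  proof (rule S_representing_atoms)
    fix n
    have "(\<Sum>m. ennreal (trunk_mass 1 m / 4 ^ m * (4 ^ m) ^ n)) = ennreal (\<gamma> n)"
      using \<gamma>_sums[of n] r_nonneg by (subst suminf_ennreal2) (auto simp: sums_iff)
    moreover have "ennreal (trunk_mass 1 m / 4 ^ m * (4 ^ m) ^ n) = ennreal (trunk_mass 1 m / 4 ^ m) * ennreal ((4 ^ m) ^ n)" for m
      using r_nonneg[of m] by (intro ennreal_mult) simp_all
    ultimately show "(\<Sum>m. ennreal (trunk_mass 1 m / 4 ^ m) * ennreal ((4 ^ m) ^ n)) = ennreal (\<gamma> n)"
      by simp
  qed (simp_all add: \<gamma>_nonneg)
  moreover have "S_representing \<gamma> \<nu>"
    unfolding \<nu>_def R_def
  proof (rule S_representing_atoms)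
    fix n
    have "(\<lambda>k. a k * y k ^ n) sums \<gamma> n"
    proof (cases n)
      case 0
      have "(\<lambda>k. 2 * c * (qcoeff (Suc (2 * k)) * (1 / 4) ^ Suc (2 * k))) sums (2 * c * odd_part (1 / 4))"
        by (intro sums_mult odd_part_sums) simp
      moreover have "2 * c * (qcoeff (Suc (2 * k)) * (1 / 4) ^ Suc (2 * k)) = a (Suc k) * y (Suc k) ^ n" for k
        by (simp add: 0 a_def power_divide del: qcoeff.simps power_Suc)
      ultimately have "(\<lambda>k. a (Suc k) * y (Suc k) ^ n) sums (2 * c * odd_part (1 / 4))"
        by (simp only:)
      from sums_Suc[OF this] show ?thesis
        by (simp add: 0 \<gamma>_0 a_def e_def)
    next
      case (Suc l)
      have "(\<lambda>k. 2 * c * (qcoeff (Suc (2 * k)) * (4 ^ l) ^ Suc (2 * k))) sums (2 * c * odd_part (4 ^ l))"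
        by (intro sums_mult odd_part_sums) simp
      moreover have "2 * c * (qcoeff (Suc (2 * k)) * (4 ^ l) ^ Suc (2 * k)) = a (Suc k) * y (Suc k) ^ n" for k
        unfolding Suc power_Suc[of _ l] power_4_swap[of "Suc (2 * k)" l, symmetric]
        by (simp add: a_def y_def del: qcoeff.simps power_Suc)
      ultimately have "(\<lambda>k. a (Suc k) * y (Suc k) ^ n) sums (2 * c * odd_part (4 ^ l))"
        by (simp only:)
      from sums_Suc[OF this] show ?thesis
        by (simp add: Suc \<gamma>_Suc y_def)
    qed
    then have "(\<Sum>k. ennreal (a k * y k ^ n)) = ennreal (\<gamma> n)"
      using a_nonneg y_nonneg by (subst suminf_ennreal2) (auto simp: sums_iff)
    then show "(\<Sum>k. ennreal (a k) * ennreal (y k ^ n)) = ennreal (\<gamma> n)"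
      using a_nonneg y_nonneg by (simp add: ennreal_mult)
  qed (simp_all add: \<gamma>_nonneg y_nonneg)
  moreover have "\<mu> \<noteq> \<nu>"
  proof
    assume "\<mu> = \<nu>"
    have *: "{0} \<in> sets R" "\<And>k. y k \<in> space R" "\<And>m. 4 ^ m \<in> space R"
      using y_nonneg by (auto simp: R_def space_restrict_space sets_restrict_space_iff)
    have "ennreal e \<le> (\<Sum>k. ennreal (a k) * indicator {0} (y k))"
      using sum_le_suminf[of "\<lambda>k. ennreal (a k) * indicator {0} (y k)" "{0}"] by (simp add: a_def y_def)
    also have "\<dots> = emeasure \<nu> {0}"
      unfolding \<nu>_def using * by (intro emeasure_atoms[symmetric])
    also have "\<dots> = emeasure \<mu> {0}"
      using \<open>\<mu> = \<nu>\<close> by simp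
    also have "\<dots> = 0"
      unfolding \<mu>_def using * by (subst emeasure_atoms) auto
    finally show False
      using e_pos by simp
  qed
  ultimately show ?thesis
    unfolding \<gamma>_def by (rule S_indeterminateI)
qed

lemma counterexample_weights_exists:
  assumes "0 \<le> d"
  obtains lam where "counterexample_weights \<kappa> lam"
    and "norm_power_seq (verts \<kappa>) (weighted_shift \<kappa> (\<lambda>v. complex_of_real (lam v))) (basis_vec (Trunk 0)) =
      (\<lambda>n. \<Sum>m. trunk_mass d m / 4 ^ m * (4 ^ m) ^ n)"
proof -
  interpret branching_data \<kappa> "\<lambda>m. 4 ^ m" "trunk_mass d" "branch_mass d" "\<lambda>i. 2 * i"
    by (rule branching_data) (rule assms)
  show ?thesis
    using that counterexample_weights_weight norm_power_seq_root by blast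
qed

theorem mainTheorem2:
  fixes \<kappa> :: enat
  shows "(\<exists>lam :: vertex \<Rightarrow> real. counterexample_weights \<kappa> lam)
    \<and> (\<exists>lam :: vertex \<Rightarrow> real. counterexample_weights \<kappa> lam \<and>
         H_determinate (norm_power_seq (verts \<kappa>) (weighted_shift \<kappa> (\<lambda>v. complex_of_real (lam v)))
           (basis_vec (Trunk 0))))
    \<and> (\<exists>lam :: vertex \<Rightarrow> real. counterexample_weights \<kappa> lam \<and>
         S_indeterminate (norm_power_seq (verts \<kappa>) (weighted_shift \<kappa> (\<lambda>v. complex_of_real (lam v)))
           (basis_vec (Trunk 0))))"
proof -
  obtain lam where lam: "counterexample_weights \<kappa> lam"
    "norm_power_seq (verts \<kappa>) (weighted_shift \<kappa> (\<lambda>v. complex_of_real (lam v))) (basis_vec (Trunk 0)) =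
      (\<lambda>n. \<Sum>m. trunk_mass 0 m / 4 ^ m * (4 ^ m) ^ n)"
    by (rule counterexample_weights_exists[of 0 \<kappa>]) simp
  have lam_moments: "H_determinate (norm_power_seq (verts \<kappa>) (weighted_shift \<kappa> (\<lambda>v. complex_of_real (lam v))) (basis_vec (Trunk 0)))"
    unfolding lam(2) by (rule H_determinate_odd)
  obtain lam' where lam': "counterexample_weights \<kappa> lam'"
    "norm_power_seq (verts \<kappa>) (weighted_shift \<kappa> (\<lambda>v. complex_of_real (lam' v))) (basis_vec (Trunk 0)) =
      (\<lambda>n. \<Sum>m. trunk_mass 1 m / 4 ^ m * (4 ^ m) ^ n)"
    by (rule counterexample_weights_exists[of 1 \<kappa>]) simp
  have lam'_moments: "S_indeterminate (norm_power_seq (verts \<kappa>) (weighted_shift \<kappa> (\<lambda>v. complex_of_real (lam' v))) (basis_vec (Trunk 0)))"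
    unfolding lam'(2) by (rule S_indeterminate_mixture)
  show ?thesis
    using lam(1) lam_moments lam'(1) lam'_moments by blast
qed

end
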